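(* Let $G$ be a finite-dimensional Lie group with identity $e$ and Lie algebra $\mathfrak{g} = T_eG$, endowed with a left-invariant Riemannian metric $\langle\cdot,\cdot\rangle$, and let $\nabla$ be its Levi-Civita connection. Let $\gamma : [0,1] \to G$ be a smooth curve and let $Y$ be a smooth vector field along $\gamma$ (so $Y(t) \in T_{\gamma(t)}G$ for all $t$). Then $Y$ is parallel along $\gamma$, i.e. $\nabla_{\dot\gamma(t)} Y(t) = 0$ for all $t \in [0,1]$, if and only if it is a solution of $$\begin{cases} \omega(t) = dL_{\gamma(t)}^{-1}\,\dot\gamma(t), \\ Y(t) = dL_{\gamma(t)}\,\zeta(t), \\ \dot\zeta(t) = -\alpha(\omega(t), \zeta(t)), \end{cases}$$ for all $t \in [0,1]$; that is, if and only if the $\mathfrak{g}$-valued curves $\omega(t) := dL_{\gamma(t)}^{-1}\dot\gamma(t)$ and $\zeta(t) := dL_{\gamma(t)}^{-1} Y(t)$ satisfy $\dot\zeta(t) = -\alpha(\omega(t),\zeta(t))$ for all $t \in [0,1]$, where $\alpha : \mathfrak{g}\times\mathfrak{g} \to \mathfrak{g}$ is the bilinear map $$\alpha(x,y) = \tfrac{1}{2}\big([x,y] - \mathrm{ad}_x^*(y) - \mathrm{ad}_y^*(x)\big).$$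
   Context: For $g \in G$, $L_g : G \to G$, $h \mapsto gh$, is left translation and $dL_g$ its differential; in the claim $dL_g$ is taken at $e$, so it is an isomorphism $\mathfrak{g} = T_eG \to T_gG$ with inverse $dL_g^{-1} : T_gG \to \mathfrak{g}$. For $x \in \mathfrak{g}$, $\tilde{x}$ denotes the left-invariant vector field $\tilde{x}_g = dL_g x$. The bracket on $\mathfrak{g}$ is $[x,y] = [\tilde{x},\tilde{y}]_e$, and $\mathrm{ad}_x(y) = [x,y]$. The metric is left-invariant if $\langle u,v\rangle_g = \langle dL_h u, dL_h v\rangle_{hg}$ for all $g,h \in G$ and $u,v \in T_gG$. For $a \in \mathfrak{g}$, $\mathrm{ad}_a^* : \mathfrak{g} \to \mathfrak{g}$ is the metric adjoint of $\mathrm{ad}_a$, defined by $\langle \mathrm{ad}_a^*(b), c\rangle_e = \langle b, \mathrm{ad}_a(c)\rangle_e = \langle [a,c], b\rangle_e$ for all $b,c \in \mathfrak{g}$. One has $\alpha(x,y) = (\nabla_{\tilde{x}}\tilde{y})_e$ for $x,y\in\mathfrak{g}$. $\nabla_{\dot\gamma(t)}Y(t)$ denotes the covariant derivative of $Y$ along $\gamma$ induced by $\nabla$. The dot denotes the derivative with respect to $t$; $\dot\zeta$ is the ordinary derivative of a curve in the vector space $\mathfrak{g}$. *)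

theory Defs
  imports "HOL-Analysis.Analysis"
begin

(* Only meaningful for open S.  On a finite-dimensional domain this is C^k: all iterated
   directional derivatives of order at most k exist and are continuous. *)
primrec Ck_on :: "nat \<Rightarrow> ('a::real_normed_vector \<Rightarrow> 'b::real_normed_vector) \<Rightarrow> 'a set \<Rightarrow> bool"
where
  "Ck_on 0 f S \<longleftrightarrow> continuous_on S f"
| "Ck_on (Suc k) f S \<longleftrightarrow> (\<forall>x\<in>S. f differentiable (at x)) \<and>
     (\<forall>v. Ck_on k (\<lambda>x. frechet_derivative f (at x) v) S)"

(* For an arbitrary set S (e.g. a compact interval): f has a smooth extension near each point
   of S.  For open S this is ordinary smoothness. *)
definition smooth_on :: "('a::real_normed_vector \<Rightarrow> 'b::real_normed_vector) \<Rightarrow> 'a set \<Rightarrow> bool" where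
  "smooth_on f S \<longleftrightarrow>
     (\<forall>x\<in>S. \<exists>U h. open U \<and> x \<in> U \<and> (\<forall>k. Ck_on k h U) \<and> (\<forall>y\<in>S \<inter> U. f y = h y))"

(* A chart is a pair (U, \<phi>); the values of \<phi> outside U are irrelevant. *)
type_synonym ('a, 'b) chart = "'a set \<times> ('a \<Rightarrow> 'b)"
type_synonym ('a, 'b) atlas = "('a, 'b) chart set"

definition chart_inv :: "('a, 'b) chart \<Rightarrow> 'b \<Rightarrow> 'a" where
  "chart_inv c = inv_into (fst c) (snd c)"

(* The model space 'b is any finite-dimensional inner product space, rather than a
   euclidean_space, so that dimension 0 is included.  Its inner product plays no role beyond
   inducing the topology. *)
definition smooth_manifold ::
  "('a::{t2_space,second_countable_topology}, 'b::real_inner) atlas \<Rightarrow> bool"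
where
  "smooth_manifold A \<longleftrightarrow>
     (\<exists>B::'b set. finite B \<and> span B = UNIV) \<and>
     (\<forall>c\<in>A. open (fst c) \<and> open (snd c ` fst c) \<and>
            homeomorphism (fst c) (snd c ` fst c) (snd c) (chart_inv c)) \<and>
     (\<Union>c\<in>A. fst c) = UNIV \<and>
     (\<forall>c\<in>A. \<forall>d\<in>A. smooth_on (snd d \<circ> chart_inv c) (snd c ` (fst c \<inter> fst d)))"

definition prod_atlas :: "('a, 'b) atlas \<Rightarrow> ('c, 'd) atlas \<Rightarrow> ('a \<times> 'c, 'b \<times> 'd) atlas" where
  "prod_atlas A B = (\<lambda>(c, d). (fst c \<times> fst d, map_prod (snd c) (snd d))) ` (A \<times> B)"

definition smooth_map ::
  "('a::topological_space, 'b::real_normed_vector) atlas \<Rightarrow>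
   ('c::topological_space, 'd::real_normed_vector) atlas \<Rightarrow> ('a \<Rightarrow> 'c) \<Rightarrow> bool"
where
  "smooth_map A B f \<longleftrightarrow> continuous_on UNIV f \<and>
     (\<forall>c\<in>A. \<forall>d\<in>B. smooth_on (snd d \<circ> f \<circ> chart_inv c) (snd c ` (fst c \<inter> f -` fst d)))"

definition smooth_fun :: "('a, 'b::real_normed_vector) atlas \<Rightarrow> ('a \<Rightarrow> real) \<Rightarrow> bool" where
  "smooth_fun A f \<longleftrightarrow> (\<forall>c\<in>A. smooth_on (f \<circ> chart_inv c) (snd c ` fst c))"

(* The tangent space at p is represented by the model space 'b: a vector v stands for the
   tangent vector at p whose components in the chart chart_at A p are v, i.e. for the class of
   (chart_at A p, v) in the description of tangent vectors as classes of pairs (chart,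
   components).  chart_at is an arbitrary fixed choice of a chart around each point; it need
   not be locally constant, so smoothness is always tested after converting the components to
   a fixed chart. *)
definition chart_at :: "('a, 'b) atlas \<Rightarrow> 'a \<Rightarrow> ('a, 'b) chart" where
  "chart_at A p = (SOME c. c \<in> A \<and> p \<in> fst c)"

(* Converts components at p from chart c to chart d. *)
definition chart_change ::
  "('a, 'b::real_normed_vector) chart \<Rightarrow> ('a, 'b) chart \<Rightarrow> 'a \<Rightarrow> 'b \<Rightarrow> 'b"
where
  "chart_change c d p v = frechet_derivative (snd d \<circ> chart_inv c) (at (snd c p)) v"

definition tangent_map ::
  "('a, 'b::real_normed_vector) atlas \<Rightarrow> ('c, 'd::real_normed_vector) atlas \<Rightarrow>
   ('a \<Rightarrow> 'c) \<Rightarrow> 'a \<Rightarrow> 'b \<Rightarrow> 'd"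
where
  "tangent_map A B f p v =
     frechet_derivative (snd (chart_at B (f p)) \<circ> f \<circ> chart_inv (chart_at A p))
       (at (snd (chart_at A p) p)) v"

definition dir_deriv :: "('a, 'b::real_normed_vector) atlas \<Rightarrow> ('a \<Rightarrow> real) \<Rightarrow> 'a \<Rightarrow> 'b \<Rightarrow> real" where
  "dir_deriv A f p v =
     frechet_derivative (f \<circ> chart_inv (chart_at A p)) (at (snd (chart_at A p) p)) v"

(* The component function, on the image of the chart c, of the vector field X. *)
definition local_rep ::
  "('a, 'b::real_normed_vector) atlas \<Rightarrow> ('a, 'b) chart \<Rightarrow> ('a \<Rightarrow> 'b) \<Rightarrow> 'b \<Rightarrow> 'b"
where
  "local_rep A c X u = (let p = chart_inv c u in chart_change (chart_at A p) c p (X p))"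

definition vector_field :: "('a, 'b::real_normed_vector) atlas \<Rightarrow> ('a \<Rightarrow> 'b) \<Rightarrow> bool" where
  "vector_field A X \<longleftrightarrow> (\<forall>c\<in>A. smooth_on (local_rep A c X) (snd c ` fst c))"

(* [X,Y] = DY X - DX Y in local coordinates, i.e. [X,Y] f = X (Y f) - Y (X f). *)
definition lie_bracket ::
  "('a, 'b::real_normed_vector) atlas \<Rightarrow> ('a \<Rightarrow> 'b) \<Rightarrow> ('a \<Rightarrow> 'b) \<Rightarrow> 'a \<Rightarrow> 'b"
where
  "lie_bracket A X Y p =
     (let c = chart_at A p; u = snd c p; X' = local_rep A c X; Y' = local_rep A c Y
      in frechet_derivative Y' (at u) (X' u) - frechet_derivative X' (at u) (Y' u))"

(* Smoothness: the components of g in each chart are smooth. *)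
definition riemannian_metric ::
  "('a, 'b::real_normed_vector) atlas \<Rightarrow> ('a \<Rightarrow> 'b \<Rightarrow> 'b \<Rightarrow> real) \<Rightarrow> bool"
where
  "riemannian_metric A g \<longleftrightarrow>
     (\<forall>p. bilinear (g p) \<and> (\<forall>v w. g p v w = g p w v) \<and> (\<forall>v. v \<noteq> 0 \<longrightarrow> g p v v > 0)) \<and>
     (\<forall>c\<in>A. \<forall>v w. smooth_on
        (\<lambda>u. let p = chart_inv c u
             in g p (chart_change c (chart_at A p) p v) (chart_change c (chart_at A p) p w))
        (snd c ` fst c))"

definition affine_connection ::
  "('a, 'b::real_normed_vector) atlas \<Rightarrow> (('a \<Rightarrow> 'b) \<Rightarrow> ('a \<Rightarrow> 'b) \<Rightarrow> 'a \<Rightarrow> 'b) \<Rightarrow> bool"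
where
  "affine_connection A nabla \<longleftrightarrow>
     (\<forall>X Y. vector_field A X \<and> vector_field A Y \<longrightarrow> vector_field A (nabla X Y)) \<and>
     (\<forall>X X' Y p. vector_field A X \<and> vector_field A X' \<and> vector_field A Y \<longrightarrow>
        nabla (\<lambda>q. X q + X' q) Y p = nabla X Y p + nabla X' Y p) \<and>
     (\<forall>f X Y p. smooth_fun A f \<and> vector_field A X \<and> vector_field A Y \<longrightarrow>
        nabla (\<lambda>q. f q *\<^sub>R X q) Y p = f p *\<^sub>R nabla X Y p) \<and>
     (\<forall>X Y Y' p. vector_field A X \<and> vector_field A Y \<and> vector_field A Y' \<longrightarrow>
        nabla X (\<lambda>q. Y q + Y' q) p = nabla X Y p + nabla X Y' p) \<and>
     (\<forall>f X Y p. smooth_fun A f \<and> vector_field A X \<and> vector_field A Y \<longrightarrow>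
        nabla X (\<lambda>q. f q *\<^sub>R Y q) p = dir_deriv A f p (X p) *\<^sub>R Y p + f p *\<^sub>R nabla X Y p)"

definition levi_civita ::
  "('a, 'b::real_normed_vector) atlas \<Rightarrow> ('a \<Rightarrow> 'b \<Rightarrow> 'b \<Rightarrow> real) \<Rightarrow>
   (('a \<Rightarrow> 'b) \<Rightarrow> ('a \<Rightarrow> 'b) \<Rightarrow> 'a \<Rightarrow> 'b) \<Rightarrow> bool"
where
  "levi_civita A g nabla \<longleftrightarrow>
     affine_connection A nabla \<and>
     (\<forall>X Y p. vector_field A X \<and> vector_field A Y \<longrightarrow>
        nabla X Y p - nabla Y X p = lie_bracket A X Y p) \<and>
     (\<forall>X Y Z p. vector_field A X \<and> vector_field A Y \<and> vector_field A Z \<longrightarrow>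
        dir_deriv A (\<lambda>q. g q (Y q) (Z q)) p (X p) = g p (nabla X Y p) (Z p) + g p (Y p) (nabla X Z p))"

definition smooth_curve ::
  "('a::topological_space, 'b::real_normed_vector) atlas \<Rightarrow> real set \<Rightarrow> (real \<Rightarrow> 'a) \<Rightarrow> bool"
where
  "smooth_curve A I \<gamma> \<longleftrightarrow> continuous_on I \<gamma> \<and>
     (\<forall>c\<in>A. smooth_on (snd c \<circ> \<gamma>) (I \<inter> \<gamma> -` fst c))"

(* One-sided at the end points of the interval I. *)
definition velocity ::
  "('a, 'b::real_normed_vector) atlas \<Rightarrow> real set \<Rightarrow> (real \<Rightarrow> 'a) \<Rightarrow> real \<Rightarrow> 'b"
where
  "velocity A I \<gamma> t = vector_derivative (snd (chart_at A (\<gamma> t)) \<circ> \<gamma>) (at t within I)"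

definition field_along ::
  "('a, 'b::real_normed_vector) atlas \<Rightarrow> real set \<Rightarrow> (real \<Rightarrow> 'a) \<Rightarrow> (real \<Rightarrow> 'b) \<Rightarrow> bool"
where
  "field_along A I \<gamma> V \<longleftrightarrow>
     (\<forall>c\<in>A. smooth_on (\<lambda>t. chart_change (chart_at A (\<gamma> t)) c (\<gamma> t) (V t)) (I \<inter> \<gamma> -` fst c))"

(* The textbook characterization of the covariant derivative D along \<gamma> induced by nabla, as
   the operator on smooth vector fields along \<gamma> that is additive, satisfies the Leibniz rule
   (hence is linear over the reals), and agrees with nabla on restrictions to \<gamma> of smooth
   vector fields X on the manifold.  In the last clause, W is any vector field with value
   velocity A I \<gamma> t at \<gamma> t; nabla W X (\<gamma> t) depends on W only through that value. *)
definition covariant_derivative_along ::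
  "('a, 'b::real_normed_vector) atlas \<Rightarrow> (('a \<Rightarrow> 'b) \<Rightarrow> ('a \<Rightarrow> 'b) \<Rightarrow> 'a \<Rightarrow> 'b) \<Rightarrow>
   real set \<Rightarrow> (real \<Rightarrow> 'a) \<Rightarrow> ((real \<Rightarrow> 'b) \<Rightarrow> real \<Rightarrow> 'b) \<Rightarrow> bool"
where
  "covariant_derivative_along A nabla I \<gamma> D \<longleftrightarrow>
     (\<forall>V. field_along A I \<gamma> V \<longrightarrow> field_along A I \<gamma> (D V)) \<and>
     (\<forall>V W. field_along A I \<gamma> V \<and> field_along A I \<gamma> W \<longrightarrow>
        (\<forall>t\<in>I. D (\<lambda>s. V s + W s) t = D V t + D W t)) \<and>
     (\<forall>f V. smooth_on f I \<and> field_along A I \<gamma> V \<longrightarrow>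
        (\<forall>t\<in>I. D (\<lambda>s. f s *\<^sub>R V s) t =
                 vector_derivative f (at t within I) *\<^sub>R V t + f t *\<^sub>R D V t)) \<and>
     (\<forall>V X. field_along A I \<gamma> V \<and> vector_field A X \<and> (\<forall>t\<in>I. V t = X (\<gamma> t)) \<longrightarrow>
        (\<forall>t\<in>I. \<forall>W. vector_field A W \<and> W (\<gamma> t) = velocity A I \<gamma> t \<longrightarrow>
                 D V t = nabla W X (\<gamma> t)))"

definition lie_group ::
  "('a::{t2_space,second_countable_topology}, 'b::real_inner) atlas \<Rightarrow>
   ('a \<Rightarrow> 'a \<Rightarrow> 'a) \<Rightarrow> 'a \<Rightarrow> ('a \<Rightarrow> 'a) \<Rightarrow> bool"
where
  "lie_group A mul e iv \<longleftrightarrow>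
     smooth_manifold A \<and> group mul e iv \<and>
     smooth_map (prod_atlas A A) A (\<lambda>(g, h). mul g h) \<and> smooth_map A A iv"

definition dL ::
  "('a, 'b::real_normed_vector) atlas \<Rightarrow> ('a \<Rightarrow> 'a \<Rightarrow> 'a) \<Rightarrow> 'a \<Rightarrow> 'a \<Rightarrow> 'b \<Rightarrow> 'b"
where
  "dL A mul h p = tangent_map A A (mul h) p"

definition left_invariant_metric ::
  "('a, 'b::real_normed_vector) atlas \<Rightarrow> ('a \<Rightarrow> 'a \<Rightarrow> 'a) \<Rightarrow> ('a \<Rightarrow> 'b \<Rightarrow> 'b \<Rightarrow> real) \<Rightarrow> bool"
where
  "left_invariant_metric A mul g \<longleftrightarrow>
     (\<forall>p h u v. g p u v = g (mul h p) (dL A mul h p u) (dL A mul h p v))"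

definition left_field ::
  "('a, 'b::real_normed_vector) atlas \<Rightarrow> ('a \<Rightarrow> 'a \<Rightarrow> 'a) \<Rightarrow> 'a \<Rightarrow> 'b \<Rightarrow> 'a \<Rightarrow> 'b"
where
  "left_field A mul e x = (\<lambda>p. dL A mul p e x)"

definition ad ::
  "('a, 'b::real_normed_vector) atlas \<Rightarrow> ('a \<Rightarrow> 'a \<Rightarrow> 'a) \<Rightarrow> 'a \<Rightarrow> 'b \<Rightarrow> 'b \<Rightarrow> 'b"
where
  "ad A mul e x y = lie_bracket A (left_field A mul e x) (left_field A mul e y) e"

definition ad_star ::
  "('a, 'b::real_normed_vector) atlas \<Rightarrow> ('a \<Rightarrow> 'a \<Rightarrow> 'a) \<Rightarrow> 'a \<Rightarrow>
   ('a \<Rightarrow> 'b \<Rightarrow> 'b \<Rightarrow> real) \<Rightarrow> 'b \<Rightarrow> 'b \<Rightarrow> 'b"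
where
  "ad_star A mul e g a b = (THE d. \<forall>c. g e d c = g e b (ad A mul e a c))"

definition alpha ::
  "('a, 'b::real_normed_vector) atlas \<Rightarrow> ('a \<Rightarrow> 'a \<Rightarrow> 'a) \<Rightarrow> 'a \<Rightarrow>
   ('a \<Rightarrow> 'b \<Rightarrow> 'b \<Rightarrow> real) \<Rightarrow> 'b \<Rightarrow> 'b \<Rightarrow> 'b"
where
  "alpha A mul e g x y =
     (1/2) *\<^sub>R (ad A mul e x y - ad_star A mul e g x y - ad_star A mul e g y x)"

end

theory Submission
  imports Defs
begin

text \<open>The left-invariant fields \<open>E\<^sub>b\<close> of a basis \<open>b\<close> of the Lie algebra form a global frame, so
  \<open>Y = \<Sum> \<zeta>\<^sub>b (E\<^sub>b \<circ> \<gamma>)\<close> along all of \<open>\<gamma>\<close>, and no localization is needed to apply the Leibniz rule: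
  \<open>D Y = \<Sum> \<zeta>\<^sub>b' E\<^sub>b + \<Sum> \<zeta>\<^sub>b \<nabla>\<^sub>W E\<^sub>b\<close> with \<open>W\<close> the left-invariant field through the velocity at time \<open>t\<close>.
  Since inner products of left-invariant fields are constant and their brackets are left-invariant,
  Koszul's formula gives \<open>\<nabla>\<^sub>X Y = \<alpha>(X, Y)\<close> on left-invariant fields, whence
  \<open>D Y = dL (\<zeta>' + \<alpha>(\<omega>, \<zeta>))\<close>. The coefficients \<open>\<zeta>\<^sub>b\<close> are smooth because \<open>\<zeta>\<close> is recovered linearly
  from the numbers \<open>\<langle>Y, E\<^sub>b\<rangle>\<close>.\<close>

section \<open>Finite-dimensional inner product spaces\<close>

text \<open>The analytic weight lies in the left-invariance of brackets: in charts, differentiating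
  the relation between two fields produces a second-derivative term, and only symmetry of second
  derivatives makes it cancel from the bracket. Hence the mean value argument for second
  differences. The model space is only known to be a real inner product space with a finite spanning
  set, possibly of dimension 0, so an orthonormal basis is carried explicitly and finite-dimensional
  arguments become expansions over it. \<open>chart_at\<close> may jump from point to point, so
  smooth dependence on the point cannot be read off components in the chosen charts; maps are first
  rewritten in fixed charts, by a chain rule valid for arbitrary charts at both ends. Inverting
  \<open>dL\<close> directly along the curve would require smooth dependence of an inverse on time.
  Pairing with left-invariant fields leaves instead the Gram operator of the metric at
  \<open>e\<close>, which does not depend on time.\<close>

definition orthonormal_basis :: "'b::real_inner set \<Rightarrow> bool" where
  "orthonormal_basis B \<longleftrightarrow>
     finite B \<and> (\<forall>b\<in>B. \<forall>c\<in>B. b \<bullet> c = (if b = c then 1 else 0)) \<and> span B = UNIV"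

lemma orthonormal_basis_exists:
  fixes S :: "'b::real_inner set"
  assumes "finite S" "span S = UNIV"
  obtains B :: "'b set" where "orthonormal_basis B"
proof -
  obtain C where C: "finite C" "span C = (UNIV::'b set)" "pairwise orthogonal C"
    using basis_orthogonal[OF assms(1)] assms(2) by metis
  \<comment> \<open>An orthogonal spanning set may contain 0, which cannot be normalized; dropping
    it leaves the span unchanged.\<close>
  define B where "B = (\<lambda>c. c /\<^sub>R norm c) ` (C - {0})"
  have 1: "b \<bullet> c = (if b = c then 1 else 0)" if bc: "b \<in> B" "c \<in> B" for b c
  proof -
    obtain b' c' where b': "b' \<in> C - {0}" "b = b' /\<^sub>R norm b'"
      and c': "c' \<in> C - {0}" "c = c' /\<^sub>R norm c'"
      using bc B_def by auto
    show ?thesis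
    proof (cases "b' = c'")
      case True
      then show ?thesis using b' c'
        by (simp add: dot_square_norm power2_eq_square)
    next
      case False
      then have "b' \<bullet> c' = 0"
        using C(3) b' c' by (auto simp: pairwise_def orthogonal_def)
      then have 0: "b \<bullet> c = 0" using b' c' by simp
      \<comment> \<open>Distinct vectors of \<open>C\<close> could a priori have the same
        normalization; being orthogonal and nonzero, \<open>b\<close> and \<open>c\<close> must
        differ.\<close>
      have "b \<noteq> 0" using b' by simp
      with 0 show ?thesis by auto
    qed
  qed
  have "C \<subseteq> span B"
  proof
    fix c assume c: "c \<in> C"
    show "c \<in> span B"
    proof (cases "c = 0")
      case True
      then show ?thesis by (simp add: span_zero)
    next
      case False
      then have "c /\<^sub>R norm c \<in> B" using c B_def by blast
      then have "norm c *\<^sub>R (c /\<^sub>R norm c) \<in> span B"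
        by (meson span_base span_scale)
      then show ?thesis using False by simp
    qed
  qed
  then have "span B = UNIV"
    using C(2) by (metis span_minimal subspace_span top.extremum_uniqueI)
  then have "orthonormal_basis B"
    unfolding orthonormal_basis_def using 1 C(1) B_def by auto
  then show ?thesis using that by blast
qed

lemma orthonormal_basis_expand:
  assumes "orthonormal_basis B"
  shows "(\<Sum>b\<in>B. (v \<bullet> b) *\<^sub>R b) = v"
proof -
  have fin: "finite B" using assms by (simp add: orthonormal_basis_def)
  have "v \<in> span B" using assms by (simp add: orthonormal_basis_def)
  then show ?thesis
  proof (induction rule: span_induct_alt)
    case base
    then show ?case by simp
  next
    case (step c x y)
    have "(\<Sum>b\<in>B. (x \<bullet> b) *\<^sub>R b) = (\<Sum>b\<in>B. if b = x then x else 0)"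
      using assms step(1) by (intro sum.cong) (auto simp: orthonormal_basis_def)
    also have "\<dots> = x" using step(1) fin by simp
    finally show ?case
      using step(2)
      by (simp add: inner_add_left scaleR_add_left sum.distrib
          flip: scaleR_scaleR scaleR_sum_right)
  qed
qed

lemma orthonormal_basis_sum_inner:
  assumes B: "orthonormal_basis B" and c: "c \<in> B"
  shows "(\<Sum>b\<in>B. h b *\<^sub>R b) \<bullet> c = h c"
proof -
  have "(h b *\<^sub>R b) \<bullet> c = (if b = c then h c else 0)" if "b \<in> B" for b
  proof -
    have "b \<bullet> c = (if b = c then 1 else 0)"
      using B c that unfolding orthonormal_basis_def by blast
    then show ?thesis by simp
  qed
  then have "(\<Sum>b\<in>B. h b *\<^sub>R b) \<bullet> c = (\<Sum>b\<in>B. if b = c then h c else 0)"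
    unfolding inner_sum_left by (rule sum.cong[OF refl])
  then show ?thesis using c B by (simp add: orthonormal_basis_def)
qed

text \<open>Group multiplication is differentiated in product charts, so the chain rule needs a
  basis of the product of the model space with itself. The two halves are disjoint because neither
  basis contains 0.\<close>

lemma orthonormal_basis_Times:
  assumes "orthonormal_basis B" "orthonormal_basis C"
  shows "orthonormal_basis ((\<lambda>b. (b, 0)) ` B \<union> (\<lambda>c. (0, c)) ` C)"
proof -
  let ?P = "(\<lambda>b. (b, 0)) ` B \<union> (\<lambda>c. (0, c)) ` C"
  have nz: "0 \<notin> B" "0 \<notin> C" using assms by (force simp: orthonormal_basis_def)+
  have "x \<in> span ?P" for x
  proof -
    have "x = (\<Sum>b\<in>B. (fst x \<bullet> b) *\<^sub>R (b, 0)) + (\<Sum>c\<in>C. (snd x \<bullet> c) *\<^sub>R (0, c))"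
      using orthonormal_basis_expand[OF assms(1), of "fst x"]
        orthonormal_basis_expand[OF assms(2), of "snd x"]
      by (intro prod_eqI) (simp_all add: fst_sum snd_sum)
    also have "\<dots> \<in> span ?P"
      by (intro span_add span_sum span_scale span_base) auto
    finally show ?thesis .
  qed
  then show ?thesis
    using assms nz unfolding orthonormal_basis_def
    by (auto simp: inner_prod_def split: if_splits) blast+
qed

lemma orthonormal_basis_linear_expand:
  assumes "orthonormal_basis B" "linear L"
  shows "L v = (\<Sum>b\<in>B. (v \<bullet> b) *\<^sub>R L b)"
proof -
  have "L v = L (\<Sum>b\<in>B. (v \<bullet> b) *\<^sub>R b)"
    using orthonormal_basis_expand[OF assms(1)] by simp
  also have "\<dots> = (\<Sum>b\<in>B. (v \<bullet> b) *\<^sub>R L b)"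
    using assms(2) by (simp add: linear_sum linear_scale)
  finally show ?thesis .
qed

lemma orthonormal_basis_linear_imp_bounded_linear:
  fixes L :: "'b::real_inner \<Rightarrow> 'c::real_normed_vector" and B :: "'b set"
  assumes "orthonormal_basis B" "linear L"
  shows "bounded_linear L"
proof -
  have "bounded_linear (\<lambda>v. \<Sum>b\<in>B. (v \<bullet> b) *\<^sub>R L b)"
    by (intro bounded_linear_sum bounded_linear_scaleR_left[THEN bounded_linear_compose]
        bounded_linear_inner_left)
  moreover have "L = (\<lambda>v. \<Sum>b\<in>B. (v \<bullet> b) *\<^sub>R L b)"
    using orthonormal_basis_linear_expand[OF assms] by blast
  ultimately show ?thesis by simp
qed

lemma orthonormal_basis_independent:
  assumes "orthonormal_basis B"
  shows "independent B"
proof -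
  have "0 \<notin> B" using assms by (force simp: orthonormal_basis_def)
  moreover have "pairwise orthogonal B"
    using assms by (auto simp: orthonormal_basis_def pairwise_def orthogonal_def)
  ultimately show ?thesis by (simp add: pairwise_orthogonal_independent)
qed

text \<open>An orthonormal basis is independent, so it instantiates the locale of finite-dimensional
  vector spaces, where rank and nullity decide.\<close>

lemma orthonormal_basis_linear_inj_imp_surj:
  fixes L :: "'b::real_inner \<Rightarrow> 'b" and B :: "'b set"
  assumes B: "orthonormal_basis B" and "linear L" "inj L"
  shows "surj L"
proof -
  have "finite B" "span B = UNIV" using B by (auto simp: orthonormal_basis_def)
  then interpret fd: finite_dimensional_vector_space "scaleR :: real \<Rightarrow> 'b \<Rightarrow> 'b" B
    using orthonormal_basis_independent[OF B]
    by unfold_locales (simp_all add: dependent_raw_def span_raw_def)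
  have "Vector_Spaces.linear (*\<^sub>R) (*\<^sub>R) L" using assms(2) linear_def by auto
  then show ?thesis using fd.linear_inj_imp_surj assms(3) by blast
qed

section \<open>Calculus of functions of class C k\<close>

text \<open>On an open set a derivative at a point depends only on nearby values, so the agreement
  passes to directional derivatives and the induction repeats.\<close>

lemma Ck_on_cong:
  assumes "open S" "\<And>x. x \<in> S \<Longrightarrow> f x = h x"
  shows "Ck_on k f S \<longleftrightarrow> Ck_on k h S"
  using assms(2)
proof (induction k arbitrary: f h)
  case 0
  then show ?case by (simp cong: continuous_on_cong)
next
  case (Suc k)
  have 1: "(f has_derivative D) (at x) \<longleftrightarrow> (h has_derivative D) (at x)" if "x \<in> S" for x D
    using has_derivative_transform_within_open[OF _ assms(1) that, of f D UNIV h]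
      has_derivative_transform_within_open[OF _ assms(1) that, of h D UNIV f] Suc.prems by auto
  then have "frechet_derivative f (at x) = frechet_derivative h (at x)" if "x \<in> S" for x
    using that by (simp add: frechet_derivative_def)
  then have "Ck_on k (\<lambda>x. frechet_derivative f (at x) v) S
      = Ck_on k (\<lambda>x. frechet_derivative h (at x) v) S" for v
    by (intro Suc.IH) simp
  with 1 show ?case by (simp add: differentiable_def)
qed

lemma Ck_on_subset: "Ck_on k f S \<Longrightarrow> T \<subseteq> S \<Longrightarrow> Ck_on k f T"
  by (induction k arbitrary: f) (auto intro: continuous_on_subset)

lemma Ck_on_Suc_D: "Ck_on (Suc k) f S \<Longrightarrow> Ck_on k f S"
proof (induction k arbitrary: f)
  case 0
  then show ?case
    by (auto intro!: continuous_at_imp_continuous_on differentiable_imp_continuous_within)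
next
  case (Suc k)
  from Suc.prems have "\<And>v. Ck_on (Suc k) (\<lambda>x. frechet_derivative f (at x) v) S"
    and d: "\<forall>x\<in>S. f differentiable (at x)"
    by (auto simp only: Ck_on.simps(2))
  then have "\<And>v. Ck_on k (\<lambda>x. frechet_derivative f (at x) v) S"
    using Suc.IH by blast
  with d show ?case by simp
qed

lemma Ck_on_continuous_on: "Ck_on k f S \<Longrightarrow> continuous_on S f"
  by (induction k) (auto dest: Ck_on_Suc_D simp del: Ck_on.simps(2))

text \<open>Lets an explicit formula for the derivative replace the description
  \<open>frechet_derivative\<close>; the closure properties below all go through it.\<close>

lemma Ck_on_SucI:
  assumes "open S" "\<And>x. x \<in> S \<Longrightarrow> (f has_derivative f' x) (at x)"
    and "\<And>v. Ck_on k (\<lambda>x. f' x v) S"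
  shows "Ck_on (Suc k) f S"
proof -
  have "frechet_derivative f (at x) = f' x" if "x \<in> S" for x
    using frechet_derivative_at[OF assms(2)[OF that]] by simp
  then have "Ck_on k (\<lambda>x. frechet_derivative f (at x) v) S" for v
    using Ck_on_cong[OF assms(1), of "\<lambda>x. frechet_derivative f (at x) v" "\<lambda>x. f' x v"] assms(3)
    by simp
  then show ?thesis using assms(2) by (auto simp: differentiable_def)
qed

lemma Ck_on_SucD:
  assumes "Ck_on (Suc k) f S"
  shows "x \<in> S \<Longrightarrow> (f has_derivative frechet_derivative f (at x)) (at x)"
    and "Ck_on k (\<lambda>x. frechet_derivative f (at x) v) S"
  using assms by (auto simp: frechet_derivative_works)

lemma Ck_on_const: "Ck_on k (\<lambda>x. c) S"
  by (induction k arbitrary: c) auto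

lemma Ck_on_add:
  assumes "open S" "Ck_on k f S" "Ck_on k h S"
  shows "Ck_on k (\<lambda>x. f x + h x) S"
  using assms(2,3)
proof (induction k arbitrary: f h)
  case 0
  then show ?case by (simp add: continuous_on_add)
next
  case (Suc k)
  show ?case
  proof (rule Ck_on_SucI[OF assms(1)])
    show "((\<lambda>x. f x + h x) has_derivative
        (\<lambda>v. frechet_derivative f (at x) v + frechet_derivative h (at x) v)) (at x)"
      if "x \<in> S" for x
      using has_derivative_add[OF Ck_on_SucD(1)[OF Suc.prems(1) that] Ck_on_SucD(1)[OF Suc.prems(2) that]] .
    show "Ck_on k (\<lambda>x. frechet_derivative f (at x) v + frechet_derivative h (at x) v) S" for v
      using Suc.IH[OF Ck_on_SucD(2)[OF Suc.prems(1)] Ck_on_SucD(2)[OF Suc.prems(2)]] .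
  qed
qed

lemma Ck_on_sum:
  assumes "open S" "\<And>i. i \<in> I \<Longrightarrow> Ck_on k (f i) S"
  shows "Ck_on k (\<lambda>x. \<Sum>i\<in>I. f i x) S"
  using assms(2)
  by (induction I rule: infinite_finite_induct) (auto intro!: Ck_on_const Ck_on_add[OF assms(1)])

lemma Ck_on_bounded_linear:
  assumes "bounded_linear L" "open S" "Ck_on k f S"
  shows "Ck_on k (\<lambda>x. L (f x)) S"
  using assms(3)
proof (induction k arbitrary: f)
  case 0
  then show ?case using assms(1) by (simp add: linear_continuous_on_compose bounded_linear.continuous_on)
next
  case (Suc k)
  show ?case
  proof (rule Ck_on_SucI[OF assms(2)])
    show "((\<lambda>x. L (f x)) has_derivative (\<lambda>v. L (frechet_derivative f (at x) v))) (at x)"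
      if "x \<in> S" for x
      using bounded_linear.has_derivative[OF assms(1) Ck_on_SucD(1)[OF Suc.prems that]] .
    show "Ck_on k (\<lambda>x. L (frechet_derivative f (at x) v)) S" for v
      using Suc.IH[OF Ck_on_SucD(2)[OF Suc.prems]] .
  qed
qed

lemma Ck_on_id: "open S \<Longrightarrow> Ck_on k (\<lambda>x. x) S"
proof (cases k)
  case 0
  then show ?thesis by simp
next
  case (Suc m)
  assume "open S"
  then show ?thesis unfolding Suc
    by (intro Ck_on_SucI[where f' = "\<lambda>x v. v"]) (auto intro!: Ck_on_const)
qed

lemma Ck_on_bounded_bilinear:
  assumes "bounded_bilinear P" "open S" "Ck_on k f S" "Ck_on k h S"
  shows "Ck_on k (\<lambda>x. P (f x) (h x)) S"
  using assms(3,4)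
proof (induction k arbitrary: f h)
  case 0
  then show ?case using assms(1) by (simp add: bounded_bilinear.continuous_on)
next
  case (Suc k)
  \<comment> \<open>The product rule leaves \<open>f\<close> and \<open>h\<close> undifferentiated
    in one factor each, so they too are needed at level \<open>k\<close>.\<close>
  have c: "Ck_on k f S" "Ck_on k h S" using Suc.prems Ck_on_Suc_D by blast+
  show ?case
  proof (rule Ck_on_SucI[OF assms(2)])
    show "((\<lambda>x. P (f x) (h x)) has_derivative
        (\<lambda>v. P (f x) (frechet_derivative h (at x) v) + P (frechet_derivative f (at x) v) (h x))) (at x)"
      if "x \<in> S" for x
      using bounded_bilinear.FDERIV[OF assms(1) Ck_on_SucD(1)[OF Suc.prems(1) that]
          Ck_on_SucD(1)[OF Suc.prems(2) that]] .
    show "Ck_on k (\<lambda>x. P (f x) (frechet_derivative h (at x) v) + P (frechet_derivative f (at x) v) (h x)) S"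
      for v
      by (intro Ck_on_add[OF assms(2)] Suc.IH c Ck_on_SucD(2)[OF Suc.prems(1)] Ck_on_SucD(2)[OF Suc.prems(2)])
  qed
qed

lemmas Ck_on_scaleR = Ck_on_bounded_bilinear[OF bounded_bilinear_scaleR]

text \<open>\<open>Ck_on\<close> controls derivatives along fixed vectors only, while the chain rule
  evaluates the derivative of \<open>f\<close> in the moving direction given by \<open>h\<close>.
  Expanding that direction over \<open>B\<close> yields a finite sum of scalar functions times
  derivatives of \<open>f\<close> along fixed basis vectors, to which the induction hypothesis
  applies.\<close>

lemma Ck_on_compose:
  fixes f :: "'b::real_inner \<Rightarrow> 'c::real_normed_vector" and h :: "'d::real_normed_vector \<Rightarrow> 'b"
    and B :: "'b set"
  assumes B: "orthonormal_basis B" and "open S" "open T" "h ` S \<subseteq> T"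
    and "Ck_on k f T" "Ck_on k h S"
  shows "Ck_on k (\<lambda>x. f (h x)) S"
  using assms(5,6)
proof (induction k arbitrary: f)
  case 0
  then show ?case using assms(4) by (auto intro: continuous_on_compose2)
next
  case (Suc k)
  have h: "Ck_on k h S" using Suc.prems Ck_on_Suc_D by blast
  show ?case
  proof (rule Ck_on_SucI[OF assms(2)])
    let ?Df = "\<lambda>x. frechet_derivative f (at x)" and ?Dh = "\<lambda>x. frechet_derivative h (at x)"
    show "((\<lambda>x. f (h x)) has_derivative (\<lambda>v. \<Sum>b\<in>B. (?Dh x v \<bullet> b) *\<^sub>R ?Df (h x) b)) (at x)"
      if "x \<in> S" for x
    proof -
      have d: "(f has_derivative ?Df (h x)) (at (h x))"
        using Ck_on_SucD(1)[OF Suc.prems(1)] assms(4) that by blast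
      then have "((\<lambda>x. f (h x)) has_derivative (\<lambda>v. ?Df (h x) (?Dh x v))) (at x)"
        using has_derivative_compose[OF Ck_on_SucD(1)[OF Suc.prems(2) that] d] by simp
      then show ?thesis
        using orthonormal_basis_linear_expand[OF B has_derivative_linear[OF d], symmetric]
        by simp
    qed
    show "Ck_on k (\<lambda>x. \<Sum>b\<in>B. (?Dh x v \<bullet> b) *\<^sub>R ?Df (h x) b) S" for v
      by (intro Ck_on_sum[OF assms(2)] Ck_on_scaleR[OF assms(2)] h
          Suc.IH[OF Ck_on_SucD(2)[OF Suc.prems(1)]]
          Ck_on_bounded_linear[OF bounded_linear_inner_left assms(2) Ck_on_SucD(2)[OF Suc.prems(2)]])
  qed
qed

lemma Ck_on_local:
  assumes "\<And>x. x \<in> S \<Longrightarrow> \<exists>U. x \<in> U \<and> Ck_on k f (S \<inter> U) \<and> open U" "open S"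
  shows "Ck_on k f S"
  using assms(1)
proof (induction k arbitrary: f)
  case 0
  then have "isCont f x" if "x \<in> S" for x
    using that assms(2) by (metis Ck_on.simps(1) IntI continuous_on_eq_continuous_at open_Int)
  then show ?case by (simp add: continuous_at_imp_continuous_on)
next
  case (Suc k)
  then have "\<forall>x\<in>S. f differentiable at x" by fastforce
  moreover have "Ck_on k (\<lambda>x. frechet_derivative f (at x) v) S" for v
    using Suc.prems by (intro Suc.IH) (metis Ck_on_SucD(2))
  ultimately show ?case by simp
qed

section \<open>Symmetry of second derivatives\<close>

lemma has_real_derivative_along_line:
  fixes f :: "'a::real_normed_vector \<Rightarrow> real"
  assumes "(f has_derivative D) (at (p + s *\<^sub>R v))"
  shows "((\<lambda>s. f (p + s *\<^sub>R v)) has_real_derivative D v) (at s)"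
proof -
  have "((\<lambda>s. p + s *\<^sub>R v) has_derivative (\<lambda>h. h *\<^sub>R v)) (at s)"
    by (auto intro!: derivative_eq_intros)
  from has_derivative_compose[OF this assms]
  show ?thesis
    using has_derivative_linear[OF assms]
    by (simp add: has_field_derivative_def linear_scale mult.commute[of _ "D v"])
qed

text \<open>Two applications of the mean value theorem, first along \<open>v\<close> and then along
  \<open>w\<close>. \<open>E\<close> is the derivative of the derivative of \<open>f\<close> along
  \<open>v\<close>, so \<open>E y w\<close> is the mixed second derivative. Real values are
  essential for an exact intermediate point.\<close>

lemma second_difference_mean_value:
  fixes f :: "'a::real_normed_vector \<Rightarrow> real"
  assumes "r > 0"
    and f: "\<And>s t. 0 \<le> s \<Longrightarrow> s \<le> r \<Longrightarrow> 0 \<le> t \<Longrightarrow> t \<le> r \<Longrightarrow>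
      (f has_derivative D (x + s *\<^sub>R v + t *\<^sub>R w)) (at (x + s *\<^sub>R v + t *\<^sub>R w))"
    and D: "\<And>s t. 0 \<le> s \<Longrightarrow> s \<le> r \<Longrightarrow> 0 \<le> t \<Longrightarrow> t \<le> r \<Longrightarrow>
      ((\<lambda>y. D y v) has_derivative E (x + s *\<^sub>R v + t *\<^sub>R w)) (at (x + s *\<^sub>R v + t *\<^sub>R w))"
  obtains s t where "0 \<le> s" "s \<le> r" "0 \<le> t" "t \<le> r"
    "f (x + r *\<^sub>R v + r *\<^sub>R w) - f (x + r *\<^sub>R v) - f (x + r *\<^sub>R w) + f x
      = r * r * E (x + s *\<^sub>R v + t *\<^sub>R w) w"
proof -
  have 1: "((\<lambda>s. f (x + s *\<^sub>R v + t *\<^sub>R w)) has_real_derivative D (x + s *\<^sub>R v + t *\<^sub>R w) v) (at s)"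
    if "0 \<le> s" "s \<le> r" "0 \<le> t" "t \<le> r" for s t
    using has_real_derivative_along_line[of f "D (x + s *\<^sub>R v + t *\<^sub>R w)" "x + t *\<^sub>R w" s v] f[OF that]
    by (simp add: algebra_simps)
  \<comment> \<open>The increment of this function of \<open>s\<close> over the interval from 0 to
    \<open>r\<close> is the second difference; the term \<open>0 *\<^sub>R w\<close> is kept so that
    fact 1 applies at the lower edge.\<close>
  have "((\<lambda>s. f (x + s *\<^sub>R v + r *\<^sub>R w) - f (x + s *\<^sub>R v + 0 *\<^sub>R w))
      has_real_derivative D (x + s *\<^sub>R v + r *\<^sub>R w) v - D (x + s *\<^sub>R v + 0 *\<^sub>R w) v) (at s)"
    if "0 \<le> s" "s \<le> r" for s
    using 1 that assms(1) less_imp_le by (intro DERIV_diff) blast+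
  from MVT2[OF assms(1) this]
  obtain s where s: "0 < s" "s < r"
    "f (x + r *\<^sub>R v + r *\<^sub>R w) - f (x + r *\<^sub>R v) - f (x + r *\<^sub>R w) + f x
      = r * (D (x + s *\<^sub>R v + r *\<^sub>R w) v - D (x + s *\<^sub>R v) v)"
    by auto
  have "((\<lambda>t. D (x + s *\<^sub>R v + t *\<^sub>R w) v) has_real_derivative E (x + s *\<^sub>R v + t *\<^sub>R w) w) (at t)"
    if "0 \<le> t" "t \<le> r" for t
    using has_real_derivative_along_line[OF D] s that by simp
  from MVT2[OF assms(1) this]
  obtain t where "0 < t" "t < r"
    "D (x + s *\<^sub>R v + r *\<^sub>R w) v - D (x + s *\<^sub>R v) v = r * E (x + s *\<^sub>R v + t *\<^sub>R w) w"
    by auto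
  with s show ?thesis using that[of s t] by simp
qed

text \<open>The second difference does not change when \<open>v\<close> and \<open>w\<close> are
  swapped. Evaluating it in both orders equates \<open>E\<close> and \<open>F\<close> at two points
  as close to \<open>x\<close> as desired, and continuity carries the equality to
  \<open>x\<close>.\<close>

lemma symmetric_second_derivative_real:
  fixes f :: "'a::real_normed_vector \<Rightarrow> real"
  assumes S: "open S" "x \<in> S"
    and f: "\<And>y. y \<in> S \<Longrightarrow> (f has_derivative D y) (at y)"
    and v: "\<And>y. y \<in> S \<Longrightarrow> ((\<lambda>y. D y v) has_derivative E y) (at y)"
    and w: "\<And>y. y \<in> S \<Longrightarrow> ((\<lambda>y. D y w) has_derivative F y) (at y)"
    and c: "continuous_on S (\<lambda>y. E y w)" "continuous_on S (\<lambda>y. F y v)"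
  shows "E x w = F x v"
proof -
  have "\<bar>E x w - F x v\<bar> \<le> \<epsilon>" if "\<epsilon> > 0" for \<epsilon>
  proof -
    have "isCont (\<lambda>y. E y w) x" "isCont (\<lambda>y. F y v) x"
      using c S by (simp_all add: continuous_on_eq_continuous_at)
    then have "((\<lambda>y. E y w) \<longlongrightarrow> E x w) (nhds x)" "((\<lambda>y. F y v) \<longlongrightarrow> F x v) (nhds x)"
      using tendsto_at_iff_tendsto_nhds[of "\<lambda>y. E y w" x] tendsto_at_iff_tendsto_nhds[of "\<lambda>y. F y v" x]
      by (simp_all add: isCont_def)
    then have "\<forall>\<^sub>F y in nhds x. dist (E y w) (E x w) < \<epsilon>/2"
      "\<forall>\<^sub>F y in nhds x. dist (F y v) (F x v) < \<epsilon>/2"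
      using half_gt_zero[OF that] by (simp_all only: tendstoD)
    moreover have "\<forall>\<^sub>F y in nhds x. y \<in> S" using S by (simp add: eventually_nhds_in_open)
    ultimately have "\<forall>\<^sub>F y in nhds x. y \<in> S \<and> \<bar>E y w - E x w\<bar> < \<epsilon>/2 \<and> \<bar>F y v - F x v\<bar> < \<epsilon>/2"
      by eventually_elim (auto simp: dist_real_def)
    then obtain \<delta> where \<delta>: "\<delta> > 0"
      "\<And>y. dist y x < \<delta> \<Longrightarrow> y \<in> S \<and> \<bar>E y w - E x w\<bar> < \<epsilon>/2 \<and> \<bar>F y v - F x v\<bar> < \<epsilon>/2"
      unfolding eventually_nhds_metric by blast
    \<comment> \<open>With this \<open>r\<close> the whole parallelogram spanned by
      \<open>r *\<^sub>R v\<close> and \<open>r *\<^sub>R w\<close> stays within \<delta> of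
      \<open>x\<close>; the summand 1 makes the bound strict and covers
      \<open>v = w = 0\<close>.\<close>
    define r where "r = \<delta> / (1 + norm v + norm w)"
    have pos: "1 + norm v + norm w > 0" by (simp add: add_pos_nonneg)
    have r: "r > 0" using \<delta> pos by (simp add: r_def)
    have close: "dist (x + s *\<^sub>R v + t *\<^sub>R w) x < \<delta>"
      if "0 \<le> s" "s \<le> r" "0 \<le> t" "t \<le> r" for s t
    proof -
      have "dist (x + s *\<^sub>R v + t *\<^sub>R w) x \<le> s * norm v + t * norm w"
        using that norm_triangle_ineq[of "s *\<^sub>R v" "t *\<^sub>R w"] by (simp add: dist_norm add.assoc)
      also have "\<dots> \<le> r * norm v + r * norm w"
        using that by (intro add_mono mult_right_mono) auto
      also have "\<dots> < r * (1 + norm v + norm w)" using r by (simp add: algebra_simps)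
      also have "\<dots> = \<delta>" using pos by (simp add: r_def)
      finally show ?thesis .
    qed
    have close': "dist (x + s *\<^sub>R w + t *\<^sub>R v) x < \<delta>"
      if "0 \<le> s" "s \<le> r" "0 \<le> t" "t \<le> r" for s t
      using close[of t s] that by (simp add: algebra_simps)
    obtain s t where st: "0 \<le> s" "s \<le> r" "0 \<le> t" "t \<le> r"
      "f (x + r *\<^sub>R v + r *\<^sub>R w) - f (x + r *\<^sub>R v) - f (x + r *\<^sub>R w) + f x
        = r * r * E (x + s *\<^sub>R v + t *\<^sub>R w) w"
      by (rule second_difference_mean_value[OF r f v]) (rule close[THEN \<delta>(2), THEN conjunct1], assumption+)+
    obtain s' t' where st': "0 \<le> s'" "s' \<le> r" "0 \<le> t'" "t' \<le> r"
      "f (x + r *\<^sub>R w + r *\<^sub>R v) - f (x + r *\<^sub>R w) - f (x + r *\<^sub>R v) + f x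
        = r * r * F (x + s' *\<^sub>R w + t' *\<^sub>R v) v"
      by (rule second_difference_mean_value[OF r f w]) (rule close'[THEN \<delta>(2), THEN conjunct1], assumption+)+
    have "f (x + r *\<^sub>R w + r *\<^sub>R v) = f (x + r *\<^sub>R v + r *\<^sub>R w)"
      by (simp add: algebra_simps)
    with st(5) st'(5)
    have "r * r * E (x + s *\<^sub>R v + t *\<^sub>R w) w = r * r * F (x + s' *\<^sub>R w + t' *\<^sub>R v) v"
      by linarith
    moreover have "r * r \<noteq> 0" using r by simp
    ultimately have "E (x + s *\<^sub>R v + t *\<^sub>R w) w = F (x + s' *\<^sub>R w + t' *\<^sub>R v) v"
      by simp
    moreover have "\<bar>E (x + s *\<^sub>R v + t *\<^sub>R w) w - E x w\<bar> < \<epsilon>/2"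
      using \<delta>(2)[OF close[OF st(1-4)]] by simp
    moreover have "\<bar>F (x + s' *\<^sub>R w + t' *\<^sub>R v) v - F x v\<bar> < \<epsilon>/2"
      using \<delta>(2)[OF close'[OF st'(1-4)]] by simp
    ultimately show ?thesis by linarith
  qed
  then have "\<bar>E x w - F x v\<bar> \<le> 0" by (rule field_le_epsilon) simp
  then show ?thesis by simp
qed

text \<open>Reduction to the real-valued case by pairing \<open>f\<close> with an arbitrary fixed
  vector \<open>z\<close>.\<close>

lemma symmetric_second_derivative:
  fixes f :: "'a::real_normed_vector \<Rightarrow> 'b::real_inner"
  assumes "open S" "x \<in> S" "Ck_on 2 f S"
  shows "frechet_derivative (\<lambda>y. frechet_derivative f (at y) v) (at x) w =
    frechet_derivative (\<lambda>y. frechet_derivative f (at y) w) (at x) v"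
proof -
  have C: "Ck_on (Suc (Suc 0)) f S" using assms(3) by (simp add: numeral_2_eq_2)
  let ?D = "\<lambda>y. frechet_derivative f (at y)"
  let ?E = "\<lambda>v y. frechet_derivative (\<lambda>y. ?D y v) (at y)"
  have "?E v x w \<bullet> z = ?E w x v \<bullet> z" for z
  proof (rule symmetric_second_derivative_real[OF assms(1,2), where
        f = "\<lambda>y. f y \<bullet> z" and D = "\<lambda>y h. ?D y h \<bullet> z"
        and E = "\<lambda>y h. ?E v y h \<bullet> z" and F = "\<lambda>y h. ?E w y h \<bullet> z"])
    fix y assume "y \<in> S"
    then show "((\<lambda>y. f y \<bullet> z) has_derivative (\<lambda>h. ?D y h \<bullet> z)) (at y)"
      using Ck_on_SucD(1)[OF C] by (intro has_derivative_inner_left)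
  next
    fix y assume "y \<in> S"
    then show "((\<lambda>y. ?D y v \<bullet> z) has_derivative (\<lambda>h. ?E v y h \<bullet> z)) (at y)"
      "((\<lambda>y. ?D y w \<bullet> z) has_derivative (\<lambda>h. ?E w y h \<bullet> z)) (at y)"
      by (auto intro: has_derivative_inner_left[OF Ck_on_SucD(1)[OF Ck_on_SucD(2)[OF C]]])
  next
    have "continuous_on S (\<lambda>y. ?E v y w)" for v w
      by (rule Ck_on_continuous_on[OF Ck_on_SucD(2)[OF Ck_on_SucD(2)[OF C]]])
    then show "continuous_on S (\<lambda>y. ?E v y w \<bullet> z)" "continuous_on S (\<lambda>y. ?E w y v \<bullet> z)"
      by (rule continuous_on_inner[OF _ continuous_on_const])+
  qed
  then show ?thesis by (metis vector_eq_rdot)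
qed

section \<open>Smoothness on sets\<close>

lemma smooth_onE:
  assumes "smooth_on f S" "x \<in> S"
  obtains U h where "open U" "x \<in> U" "\<forall>k. Ck_on k h U" "\<forall>y\<in>S \<inter> U. f y = h y"
proof -
  from assms have "\<exists>U h. open U \<and> x \<in> U \<and> (\<forall>k. Ck_on k h U) \<and> (\<forall>y\<in>S \<inter> U. f y = h y)"
    unfolding smooth_on_def by (rule bspec)
  then show ?thesis using that by (elim exE conjE)
qed

lemma smooth_on_open:
  assumes "open S"
  shows "smooth_on f S \<longleftrightarrow> (\<forall>k. Ck_on k f S)"
proof
  assume f: "smooth_on f S"
  show "\<forall>k. Ck_on k f S"
  proof
    fix k
    show "Ck_on k f S"
    proof (rule Ck_on_local[OF _ assms])
      fix x assume "x \<in> S"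
      then obtain U h where U: "open U" "x \<in> U" "\<forall>k. Ck_on k h U" "\<forall>y\<in>S \<inter> U. f y = h y"
        using f unfolding smooth_on_def by blast
      then have "Ck_on k f (S \<inter> U)"
        using Ck_on_cong[of "S \<inter> U" f h k] assms Ck_on_subset[of k h U "S \<inter> U"] by auto
      with U show "\<exists>U. x \<in> U \<and> Ck_on k f (S \<inter> U) \<and> open U" by blast
    qed
  qed
next
  assume "\<forall>k. Ck_on k f S"
  then show "smooth_on f S"
    unfolding smooth_on_def using assms by (intro ballI exI[of _ S] exI[of _ f]) simp
qed

lemma smooth_on_cong:
  assumes "\<And>x. x \<in> S \<Longrightarrow> f x = h x"
  shows "smooth_on f S \<longleftrightarrow> smooth_on h S"
  unfolding smooth_on_def using assms by simp

lemma smooth_on_subset: "smooth_on f S \<Longrightarrow> T \<subseteq> S \<Longrightarrow> smooth_on f T"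
  unfolding smooth_on_def
proof
  fix x assume S: "\<forall>x\<in>S. \<exists>U h. open U \<and> x \<in> U \<and> (\<forall>k. Ck_on k h U) \<and> (\<forall>y\<in>S \<inter> U. f y = h y)"
    and T: "T \<subseteq> S" "x \<in> T"
  then have "x \<in> S" by blast
  with S obtain U h where "open U" "x \<in> U" "\<forall>k. Ck_on k h U" "\<forall>y\<in>S \<inter> U. f y = h y"
    by blast
  with T(1) show "\<exists>U h. open U \<and> x \<in> U \<and> (\<forall>k. Ck_on k h U) \<and> (\<forall>y\<in>T \<inter> U. f y = h y)"
    by (intro exI[of _ U] exI[of _ h]) auto
qed

lemma smooth_on_local:
  assumes "\<And>x. x \<in> S \<Longrightarrow> \<exists>U. open U \<and> x \<in> U \<and> smooth_on f (S \<inter> U)"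
  shows "smooth_on f S"
  unfolding smooth_on_def
proof
  fix x assume "x \<in> S"
  then obtain U where U: "open U" "x \<in> U" "smooth_on f (S \<inter> U)" using assms by blast
  then obtain V h where "open V" "x \<in> V" "\<forall>k. Ck_on k h V" "\<forall>y\<in>S \<inter> U \<inter> V. f y = h y"
    using \<open>x \<in> S\<close> unfolding smooth_on_def by blast
  with U show "\<exists>U h. open U \<and> x \<in> U \<and> (\<forall>k. Ck_on k h U) \<and> (\<forall>y\<in>S \<inter> U. f y = h y)"
    using Ck_on_subset[of _ h V "U \<inter> V"] by (intro exI[of _ "U \<inter> V"] exI[of _ h]) auto
qed

lemma smooth_on_const: "smooth_on (\<lambda>x. c) S"
  unfolding smooth_on_def
  by (intro ballI exI[of _ UNIV] exI[of _ "\<lambda>x. c"]) (simp add: Ck_on_const)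

lemma bounded_linear_imp_smooth_on: "bounded_linear L \<Longrightarrow> smooth_on L S"
  unfolding smooth_on_def
  by (intro ballI exI[of _ UNIV] exI[of _ L])
    (simp add: Ck_on_bounded_linear[OF _ open_UNIV Ck_on_id[OF open_UNIV]])

lemma smooth_on_common_extension:
  assumes "smooth_on f S" "smooth_on h S" "x \<in> S"
  obtains U f' h' where "open U" "x \<in> U" "\<forall>k. Ck_on k f' U" "\<forall>k. Ck_on k h' U"
    "\<forall>y\<in>S \<inter> U. f y = f' y \<and> h y = h' y"
proof -
  obtain U f' where U: "open U" "x \<in> U" "\<forall>k. Ck_on k f' U" "\<forall>y\<in>S \<inter> U. f y = f' y"
    by (rule smooth_onE[OF assms(1,3)])
  obtain V h' where V: "open V" "x \<in> V" "\<forall>k. Ck_on k h' V" "\<forall>y\<in>S \<inter> V. h y = h' y"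
    by (rule smooth_onE[OF assms(2,3)])
  show ?thesis
  proof (rule that[of "U \<inter> V" f' h'])
    show "\<forall>k. Ck_on k f' (U \<inter> V)" using Ck_on_subset[of _ f' U "U \<inter> V"] U by simp
    show "\<forall>k. Ck_on k h' (U \<inter> V)" using Ck_on_subset[of _ h' V "U \<inter> V"] V by simp
  qed (use U V in auto)
qed

lemma smooth_on_bounded_bilinear:
  assumes "bounded_bilinear P" "smooth_on f S" "smooth_on h S"
  shows "smooth_on (\<lambda>x. P (f x) (h x)) S"
  unfolding smooth_on_def
proof
  fix x assume x: "x \<in> S"
  obtain U f' h' where U: "open U" "x \<in> U" "\<forall>k. Ck_on k f' U" "\<forall>k. Ck_on k h' U"
    "\<forall>y\<in>S \<inter> U. f y = f' y \<and> h y = h' y"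
    by (rule smooth_on_common_extension[OF assms(2,3) x])
  have "Ck_on k (\<lambda>y. P (f' y) (h' y)) U" for k
    by (rule Ck_on_bounded_bilinear[OF assms(1) U(1) U(3)[rule_format] U(4)[rule_format]])
  with U show "\<exists>U k. open U \<and> x \<in> U \<and> (\<forall>m. Ck_on m k U) \<and> (\<forall>y\<in>S \<inter> U. P (f y) (h y) = k y)"
    by (intro exI[of _ U] exI[of _ "\<lambda>y. P (f' y) (h' y)"]) simp
qed

lemma smooth_on_add:
  assumes "smooth_on f S" "smooth_on h S"
  shows "smooth_on (\<lambda>x. f x + h x) S"
  unfolding smooth_on_def
proof
  fix x assume x: "x \<in> S"
  obtain U f' h' where U: "open U" "x \<in> U" "\<forall>k. Ck_on k f' U" "\<forall>k. Ck_on k h' U"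
    "\<forall>y\<in>S \<inter> U. f y = f' y \<and> h y = h' y"
    by (rule smooth_on_common_extension[OF assms x])
  have "Ck_on k (\<lambda>y. f' y + h' y) U" for k
    by (rule Ck_on_add[OF U(1) U(3)[rule_format] U(4)[rule_format]])
  with U show "\<exists>U k. open U \<and> x \<in> U \<and> (\<forall>m. Ck_on m k U) \<and> (\<forall>y\<in>S \<inter> U. f y + h y = k y)"
    by (intro exI[of _ U] exI[of _ "\<lambda>y. f' y + h' y"]) simp
qed

lemmas smooth_on_scaleR = smooth_on_bounded_bilinear[OF bounded_bilinear_scaleR]

lemma smooth_on_bounded_linear:
  assumes "bounded_linear L" "smooth_on f S"
  shows "smooth_on (\<lambda>x. L (f x)) S"
  unfolding smooth_on_def
proof
  fix x assume x: "x \<in> S"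
  obtain U f' where U: "open U" "x \<in> U" "\<forall>k. Ck_on k f' U" "\<forall>y\<in>S \<inter> U. f y = f' y"
    by (rule smooth_onE[OF assms(2) x])
  show "\<exists>U k. open U \<and> x \<in> U \<and> (\<forall>m. Ck_on m k U) \<and> (\<forall>y\<in>S \<inter> U. L (f y) = k y)"
    using U Ck_on_bounded_linear[OF assms(1) U(1)]
    by (intro exI[of _ "U"] exI[of _ "\<lambda>y. L (f' y)"]) simp
qed

lemma smooth_on_sum:
  assumes "\<And>i. i \<in> I \<Longrightarrow> smooth_on (f i) S"
  shows "smooth_on (\<lambda>x. \<Sum>i\<in>I. f i x) S"
  using assms
  by (induction I rule: infinite_finite_induct) (auto intro!: smooth_on_const smooth_on_add)

lemma smooth_on_compose:
  fixes f :: "'b::real_inner \<Rightarrow> 'c::real_normed_vector" and h :: "'d::real_normed_vector \<Rightarrow> 'b"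
    and B :: "'b set"
  assumes B: "orthonormal_basis B" and "open T" "h ` S \<subseteq> T"
    and f: "smooth_on f T" and h: "smooth_on h S"
  shows "smooth_on (\<lambda>x. f (h x)) S"
  unfolding smooth_on_def
proof
  fix x assume x: "x \<in> S"
  obtain U h' where U: "open U" "x \<in> U" "\<forall>k. Ck_on k h' U" "\<forall>y\<in>S \<inter> U. h y = h' y"
    by (rule smooth_onE[OF h x])
  have "continuous_on U h'" using U(3) Ck_on_continuous_on[of 0 h' U] by simp
  \<comment> \<open>Away from \<open>S\<close> the extension \<open>h'\<close> may leave
    \<open>T\<close>, where nothing is known about \<open>f\<close>; shrinking to the preimage of
    \<open>T\<close> avoids this.\<close>
  then have o: "open (U \<inter> h' -` T)" using U assms(2) by (simp add: continuous_open_preimage)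
  have "Ck_on k (\<lambda>x. f (h' x)) (U \<inter> h' -` T)" for k
  proof (rule Ck_on_compose[OF B o assms(2)])
    show "Ck_on k f T" using f smooth_on_open[OF assms(2)] by blast
    show "Ck_on k h' (U \<inter> h' -` T)" using U(3) Ck_on_subset[of k h' U] by simp
  qed auto
  with U o x assms(3) show "\<exists>U k. open U \<and> x \<in> U \<and> (\<forall>m. Ck_on m k U) \<and> (\<forall>y\<in>S \<inter> U. f (h y) = k y)"
    by (intro exI[of _ "U \<inter> h' -` T"] exI[of _ "\<lambda>y. f (h' y)"]) auto
qed

lemma smooth_on_frechet_derivative:
  assumes "open S" "smooth_on f S"
  shows "smooth_on (\<lambda>x. frechet_derivative f (at x) v) S"
  using assms(2) Ck_on_SucD(2)[of _ f S v] unfolding smooth_on_open[OF assms(1)] by simp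

lemma smooth_on_has_derivative:
  assumes "open S" "smooth_on f S" "x \<in> S"
  shows "(f has_derivative frechet_derivative f (at x)) (at x)"
  using assms(2,3) Ck_on_SucD(1)[of 0 f S x] unfolding smooth_on_open[OF assms(1)] by simp

text \<open>The local extension is differentiable in the full sense, and restricting to
  \<open>S\<close> gives the derivative within \<open>S\<close>. This covers the one-sided
  derivatives at the ends of an interval.\<close>

lemma smooth_on_differentiable:
  assumes "smooth_on f S" "x \<in> S"
  shows "f differentiable (at x within S)"
proof -
  obtain U h where U: "open U" "x \<in> U" "\<forall>k. Ck_on k h U" "\<forall>y\<in>S \<inter> U. f y = h y"
    by (rule smooth_onE[OF assms])
  then have "(h has_derivative frechet_derivative h (at x)) (at x)"
    using Ck_on_SucD(1)[of 0 h U x] by simp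
  then have h: "(h has_derivative frechet_derivative h (at x)) (at x within S)"
    by (rule has_derivative_at_withinI)
  have "\<forall>\<^sub>F y in at x within S. f y = h y"
    unfolding eventually_at_topological using U by blast
  then have "(f has_derivative frechet_derivative h (at x)) (at x within S)"
    using U assms(2) has_derivative_transform_eventually[OF h, of f]
    by (simp add: eq_commute)
  then show ?thesis unfolding differentiable_def by blast
qed

section \<open>Tangent maps in charts\<close>

text \<open>Both charts are free parameters, so that \<open>chart_change\<close> (for
  \<open>f = id\<close>) and \<open>dL\<close> (for a left translation and the chosen charts) become
  instances of one notion with one chain rule.\<close>

definition chart_deriv ::
  "('a, 'b::real_normed_vector) chart \<Rightarrow> ('a, 'b) chart \<Rightarrow> ('a \<Rightarrow> 'a) \<Rightarrow> 'a \<Rightarrow> 'b \<Rightarrow> 'b"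
where
  "chart_deriv c d f p = frechet_derivative (snd d \<circ> f \<circ> chart_inv c) (at (snd c p))"

lemma chart_change_eq: "chart_change c d p = chart_deriv c d id p"
  by (rule ext) (simp add: chart_change_def chart_deriv_def)

lemma tangent_map_eq:
  "tangent_map A A f p = chart_deriv (chart_at A p) (chart_at A (f p)) f p"
  by (rule ext) (simp add: tangent_map_def chart_deriv_def)

locale manifold =
  fixes A :: "('a::{t2_space,second_countable_topology}, 'b::real_inner) atlas"
  assumes manifold: "smooth_manifold A"
begin

lemma model_basis:
  obtains B :: "'b set" where "orthonormal_basis B"
  using manifold orthonormal_basis_exists unfolding smooth_manifold_def by metis

lemma chart_homeomorphism:
  assumes "c \<in> A"
  shows "open (fst c)" "open (snd c ` fst c)"
    "homeomorphism (fst c) (snd c ` fst c) (snd c) (chart_inv c)"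
  using manifold assms unfolding smooth_manifold_def by auto

lemma chart_inv_chart [simp]: "c \<in> A \<Longrightarrow> p \<in> fst c \<Longrightarrow> chart_inv c (snd c p) = p"
  using homeomorphism_apply1[OF chart_homeomorphism(3)] .

lemma chart_at_mem [simp]: "chart_at A p \<in> A" "p \<in> fst (chart_at A p)"
proof -
  have "(\<Union>c\<in>A. fst c) = UNIV" using manifold unfolding smooth_manifold_def by simp
  then have "\<exists>c. c \<in> A \<and> p \<in> fst c" by blast
  from someI_ex[OF this] show "chart_at A p \<in> A" "p \<in> fst (chart_at A p)"
    by (simp_all add: chart_at_def)
qed

lemma open_chart_image:
  assumes "c \<in> A" "open V"
  shows "open (snd c ` (fst c \<inter> V))"
proof -
  have "snd c ` (fst c \<inter> V) = snd c ` fst c \<inter> chart_inv c -` V" using assms by auto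
  moreover have "continuous_on (snd c ` fst c) (chart_inv c)"
    using homeomorphism_cont2[OF chart_homeomorphism(3)[OF assms(1)]] .
  ultimately show ?thesis
    using chart_homeomorphism(2)[OF assms(1)] assms(2) by (simp add: continuous_open_preimage)
qed

lemma open_vimage_chart:
  assumes "smooth_map A A f" "c \<in> A" "d \<in> A"
  shows "open (snd c ` (fst c \<inter> f -` fst d))"
proof -
  have "open (f -` fst d)"
    using assms(1) chart_homeomorphism(1)[OF assms(3)]
    by (auto simp: smooth_map_def intro: open_vimage)
  then show ?thesis using open_chart_image[OF assms(2)] by blast
qed

lemma smooth_map_smooth_on:
  assumes "smooth_map A A f" "c \<in> A" "d \<in> A"
  shows "smooth_on (snd d \<circ> f \<circ> chart_inv c) (snd c ` (fst c \<inter> f -` fst d))"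
  using assms unfolding smooth_map_def by simp

lemma smooth_map_id: "smooth_map A A id"
  using manifold unfolding smooth_map_def smooth_manifold_def by (simp add: continuous_on_id')

lemma has_derivative_chart_deriv:
  assumes "smooth_map A A f" "c \<in> A" "d \<in> A" "p \<in> fst c" "f p \<in> fst d"
  shows "((snd d \<circ> f \<circ> chart_inv c) has_derivative chart_deriv c d f p) (at (snd c p))"
  unfolding chart_deriv_def
  by (rule smooth_on_has_derivative[OF open_vimage_chart smooth_map_smooth_on])
    (use assms in auto)

lemma linear_chart_deriv:
  assumes "smooth_map A A f" "c \<in> A" "d \<in> A" "p \<in> fst c" "f p \<in> fst d"
  shows "linear (chart_deriv c d f p)"
  using has_derivative_linear[OF has_derivative_chart_deriv[OF assms]] .

text \<open>The chain rule, with the intermediate chart \<open>d\<close> free. The two coordinate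
  expressions agree only where \<open>f\<close> lands in the domain of \<open>d\<close>, an open set
  around the point, and this is enough for derivatives there.\<close>

lemma chart_deriv_compose:
  assumes "smooth_map A A f" "smooth_map A A h" "c \<in> A" "d \<in> A" "k \<in> A"
    and "p \<in> fst c" "f p \<in> fst d" "h (f p) \<in> fst k"
  shows "chart_deriv c k (h \<circ> f) p v = chart_deriv d k h (f p) (chart_deriv c d f p v)"
proof -
  let ?S = "snd c ` (fst c \<inter> f -` fst d)"
  have 1: "((snd k \<circ> h \<circ> chart_inv d) has_derivative chart_deriv d k h (f p))
      (at ((snd d \<circ> f \<circ> chart_inv c) (snd c p)))"
    using has_derivative_chart_deriv[OF assms(2,4,5), of "f p"] assms by simp
  have "((\<lambda>u. (snd k \<circ> h \<circ> chart_inv d) ((snd d \<circ> f \<circ> chart_inv c) u)) has_derivative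
      (\<lambda>v. chart_deriv d k h (f p) (chart_deriv c d f p v))) (at (snd c p))"
    using has_derivative_compose[OF has_derivative_chart_deriv[OF assms(1,3,4,6,7)] 1] .
  then have "((snd k \<circ> (h \<circ> f) \<circ> chart_inv c) has_derivative
      (\<lambda>v. chart_deriv d k h (f p) (chart_deriv c d f p v))) (at (snd c p))"
    by (rule has_derivative_transform_within_open[OF _ open_vimage_chart[OF assms(1,3,4)]])
      (use assms in auto)
  then show ?thesis
    unfolding chart_deriv_def[of c k] by (simp add: frechet_derivative_at[symmetric])
qed

lemma chart_deriv_id_same:
  assumes "c \<in> A" "p \<in> fst c"
  shows "chart_deriv c c id p v = v"
proof -
  have "((\<lambda>u. u) has_derivative (\<lambda>v. v)) (at (snd c p))" by (rule has_derivative_ident)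
  then have "((snd c \<circ> id \<circ> chart_inv c) has_derivative (\<lambda>v. v)) (at (snd c p))"
    by (rule has_derivative_transform_within_open[OF _ chart_homeomorphism(2)[OF assms(1)]])
      (use assms in auto)
  then show ?thesis
    unfolding chart_deriv_def by (simp add: frechet_derivative_at[symmetric])
qed

lemma linear_chart_change:
  assumes "c \<in> A" "d \<in> A" "p \<in> fst c" "p \<in> fst d"
  shows "linear (chart_change c d p)"
  unfolding chart_change_eq using linear_chart_deriv[OF smooth_map_id] assms by simp

lemma chart_change_inverse:
  assumes "c \<in> A" "d \<in> A" "p \<in> fst c" "p \<in> fst d"
  shows "chart_change d c p (chart_change c d p v) = v"
  using chart_deriv_compose[OF smooth_map_id smooth_map_id assms(1,2,1), of p v] assms
  by (simp add: chart_change_eq chart_deriv_id_same)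

lemma local_rep_chart:
  assumes "c \<in> A" "p \<in> fst c"
  shows "local_rep A c X (snd c p) = chart_change (chart_at A p) c p (X p)"
  using assms by (simp add: local_rep_def)

lemma smooth_fun_const: "smooth_fun A (\<lambda>p. k)"
  unfolding smooth_fun_def by (simp add: comp_def smooth_on_const)

lemma dir_deriv_const: "dir_deriv A (\<lambda>p. k) p v = 0"
  by (simp add: dir_deriv_def comp_def)

end

section \<open>Left-invariant fields\<close>

text \<open>Brackets of \<open>f\<close>-related fields are \<open>f\<close>-related, in
  coordinates. Differentiating \<open>Z' (f y) = Df(y) (Z y)\<close> gives the expected first-order
  term plus the Hessian of \<open>f\<close> on \<open>Z u\<close> and the direction; for the two
  fields the Hessian terms coincide by symmetry and drop out of the difference.\<close>

lemma lie_bracket_related: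
  fixes f :: "'b::real_inner \<Rightarrow> 'b" and B :: "'b set"
  assumes B: "orthonormal_basis B" and S: "open S" "u \<in> S" and f: "Ck_on 2 f S"
    and X: "(X has_derivative DX) (at u)" and Y: "(Y has_derivative DY) (at u)"
    and X': "(X' has_derivative DX') (at (f u))" and Y': "(Y' has_derivative DY') (at (f u))"
    and relX: "\<And>y. y \<in> S \<Longrightarrow> X' (f y) = frechet_derivative f (at y) (X y)"
    and relY: "\<And>y. y \<in> S \<Longrightarrow> Y' (f y) = frechet_derivative f (at y) (Y y)"
  shows "DY' (X' (f u)) - DX' (Y' (f u)) = frechet_derivative f (at u) (DY (X u) - DX (Y u))"
proof -
  let ?D = "\<lambda>y. frechet_derivative f (at y)"
  let ?E = "\<lambda>b. frechet_derivative (\<lambda>y. ?D y b) (at u)"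
  have C: "Ck_on (Suc (Suc 0)) f S" using f by (simp add: numeral_2_eq_2)
  note fd = Ck_on_SucD(1)[OF C] and fdd = Ck_on_SucD(1)[OF Ck_on_SucD(2)[OF C]]
  have lin: "linear (?D y)" if "y \<in> S" for y using has_derivative_linear[OF fd[OF that]] .
  have linE: "linear (?E b)" for b using has_derivative_linear[OF fdd[OF S(2)]] .
  \<comment> \<open>The double sum is the second derivative of \<open>f\<close> in the directions
    \<open>Z u\<close> and \<open>w\<close>, written over the basis.\<close>
  have key: "DZ' (?D u w) = ?D u (DZ w) + (\<Sum>b\<in>B. \<Sum>c\<in>B. (Z u \<bullet> b) *\<^sub>R (w \<bullet> c) *\<^sub>R ?E b c)"
    if Z: "(Z has_derivative DZ) (at u)" and Z': "(Z' has_derivative DZ') (at (f u))"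
      and relZ: "\<And>y. y \<in> S \<Longrightarrow> Z' (f y) = ?D y (Z y)" for Z Z' DZ DZ' w
  proof -
    have "((\<lambda>y. Z' (f y)) has_derivative (\<lambda>w. DZ' (?D u w))) (at u)"
      using has_derivative_compose[OF fd[OF S(2)] Z'] .
    \<comment> \<open>The relation is expanded over \<open>B\<close> because only
      \<open>?D y b\<close> with a fixed vector \<open>b\<close> is known to be differentiable in
      \<open>y\<close>. Fact 2 differentiates the same sum by the product rule, and uniqueness of
      derivatives compares the two.\<close>
    then have 1: "((\<lambda>y. \<Sum>b\<in>B. (Z y \<bullet> b) *\<^sub>R ?D y b) has_derivative (\<lambda>w. DZ' (?D u w))) (at u)"
      by (rule has_derivative_transform_within_open[OF _ S])
        (simp add: relZ orthonormal_basis_linear_expand[OF B lin])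
    have 2: "((\<lambda>y. \<Sum>b\<in>B. (Z y \<bullet> b) *\<^sub>R ?D y b) has_derivative
        (\<lambda>w. \<Sum>b\<in>B. (Z u \<bullet> b) *\<^sub>R ?E b w + (DZ w \<bullet> b) *\<^sub>R ?D u b)) (at u)"
      by (intro has_derivative_sum has_derivative_scaleR has_derivative_inner_left Z fdd S(2))
    have "DZ' (?D u w) = (\<Sum>b\<in>B. (Z u \<bullet> b) *\<^sub>R ?E b w + (DZ w \<bullet> b) *\<^sub>R ?D u b)"
      using has_derivative_unique[OF 1 2] by (rule fun_cong)
    also have "\<dots> = (\<Sum>b\<in>B. (Z u \<bullet> b) *\<^sub>R ?E b w) + ?D u (DZ w)"
      using orthonormal_basis_linear_expand[OF B lin[OF S(2)], of "DZ w"] by (simp add: sum.distrib)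
    also have "(\<Sum>b\<in>B. (Z u \<bullet> b) *\<^sub>R ?E b w) = (\<Sum>b\<in>B. \<Sum>c\<in>B. (Z u \<bullet> b) *\<^sub>R (w \<bullet> c) *\<^sub>R ?E b c)"
      using orthonormal_basis_linear_expand[OF B linE, of _ w] by (simp only: scaleR_sum_right)
    finally show ?thesis by simp
  qed
  have "(\<Sum>b\<in>B. \<Sum>c\<in>B. (Y u \<bullet> b) *\<^sub>R (X u \<bullet> c) *\<^sub>R ?E b c)
      = (\<Sum>b\<in>B. \<Sum>c\<in>B. (Y u \<bullet> c) *\<^sub>R (X u \<bullet> b) *\<^sub>R ?E c b)"
    by (rule sum.swap)
  also have "\<dots> = (\<Sum>b\<in>B. \<Sum>c\<in>B. (X u \<bullet> b) *\<^sub>R (Y u \<bullet> c) *\<^sub>R ?E b c)"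
    by (simp only: symmetric_second_derivative[OF S f] scaleR_left_commute)
  finally have sym: "(\<Sum>b\<in>B. \<Sum>c\<in>B. (Y u \<bullet> b) *\<^sub>R (X u \<bullet> c) *\<^sub>R ?E b c)
      = (\<Sum>b\<in>B. \<Sum>c\<in>B. (X u \<bullet> b) *\<^sub>R (Y u \<bullet> c) *\<^sub>R ?E b c)" .
  show ?thesis
    using key[OF X X' relX, of "Y u"] key[OF Y Y' relY, of "X u"] sym
    by (simp add: relX[OF S(2)] relY[OF S(2)] linear_diff[OF lin[OF S(2)]])
qed

locale lie_manifold = manifold A
  for A :: "('a::{t2_space,second_countable_topology}, 'b::real_inner) atlas" +
  fixes mul :: "'a \<Rightarrow> 'a \<Rightarrow> 'a" and e :: 'a and iv :: "'a \<Rightarrow> 'a"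
  assumes lie_group: "lie_group A mul e iv"
begin

sublocale grp: group mul e iv
  using lie_group by (simp add: lie_group_def)

text \<open>Inverses of product charts are given through \<open>inv_into\<close>; identifying them
  once with pairs of factor inverses makes explicit coordinates available. \<open>W\<close> is open
  because the pair of inverse charts and the multiplication are continuous.\<close>

lemma mul_smooth_in_charts:
  assumes c: "c \<in> A" and d: "d \<in> A" and k: "k \<in> A"
  defines "W \<equiv> (\<lambda>(a, b). (snd c a, snd d b)) ` {(a, b). a \<in> fst c \<and> b \<in> fst d \<and> mul a b \<in> fst k}"
  shows "open W" "smooth_on (\<lambda>z. snd k (mul (chart_inv c (fst z)) (chart_inv d (snd z)))) W"
proof -
  let ?m = "\<lambda>(a, b). mul a b"
  let ?P = "(fst c \<times> fst d, map_prod (snd c) (snd d))"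
  have sm: "smooth_map (prod_atlas A A) A ?m" using lie_group by (simp add: lie_group_def)
  have P: "?P \<in> prod_atlas A A" using c d by (force simp: prod_atlas_def)
  have inj: "inj_on (map_prod (snd c) (snd d)) (fst c \<times> fst d)"
    by (intro map_prod_inj_on) (metis c d chart_inv_chart inj_onI)+
  have inv: "chart_inv ?P (snd c a, snd d b) = (a, b)" if "a \<in> fst c" "b \<in> fst d" for a b
    using inv_into_f_f[OF inj, of "(a, b)"] that by (simp add: chart_inv_def)
  have W: "W = snd ?P ` (fst ?P \<inter> ?m -` fst k)" by (auto simp: W_def)
  have "smooth_on (snd k \<circ> ?m \<circ> chart_inv ?P) W"
    using sm P k unfolding W smooth_map_def by blast
  then show "smooth_on (\<lambda>z. snd k (mul (chart_inv c (fst z)) (chart_inv d (snd z)))) W"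
    by (rule smooth_on_cong[THEN iffD1, rotated]) (use c d inv in \<open>auto simp: W_def\<close>)
  let ?i = "\<lambda>z. (chart_inv c (fst z), chart_inv d (snd z))"
  have "continuous_on (snd c ` fst c \<times> snd d ` fst d) (\<lambda>z. chart_inv c (fst z))"
    by (rule continuous_on_compose2[OF homeomorphism_cont2[OF chart_homeomorphism(3)[OF c]]
          continuous_on_fst[OF continuous_on_id]]) auto
  moreover have "continuous_on (snd c ` fst c \<times> snd d ` fst d) (\<lambda>z. chart_inv d (snd z))"
    by (rule continuous_on_compose2[OF homeomorphism_cont2[OF chart_homeomorphism(3)[OF d]]
          continuous_on_snd[OF continuous_on_id]]) auto
  ultimately have "continuous_on (snd c ` fst c \<times> snd d ` fst d) ?i"
    by (rule continuous_on_Pair)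
  moreover have "open (?m -` fst k)"
    using sm chart_homeomorphism(1)[OF k] by (auto simp: smooth_map_def intro: open_vimage)
  moreover have "open (snd c ` fst c \<times> snd d ` fst d)"
    using chart_homeomorphism(2) c d by (intro open_Times)
  ultimately have "open ((snd c ` fst c \<times> snd d ` fst d) \<inter> ?i -` (?m -` fst k))"
    by (simp add: continuous_open_preimage)
  moreover have "W = (snd c ` fst c \<times> snd d ` fst d) \<inter> ?i -` (?m -` fst k)"
    using c d by (force simp: W_def)
  ultimately show "open W" by simp
qed

text \<open>Joint smoothness of the multiplication restricted to the slice where the first factor is
  \<open>h\<close>. In coordinates the inclusion of the slice is a constant plus a bounded linear
  map.\<close>

lemma smooth_map_left_mul: "smooth_map A A (mul h)"
  unfolding smooth_map_def
proof (intro conjI ballI)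
  have "continuous_on UNIV (\<lambda>(a, b). mul a b)"
    using lie_group by (simp add: lie_group_def smooth_map_def)
  then have "continuous_on UNIV (\<lambda>b. (\<lambda>(a, b). mul a b) (h, b))"
    by (rule continuous_on_compose2) (auto intro!: continuous_intros)
  then show "continuous_on UNIV (mul h)" by simp
next
  fix c d assume cd: "c \<in> A" "d \<in> A"
  obtain B :: "'b set" where B: "orthonormal_basis B" by (rule model_basis)
  let ?W = "(\<lambda>(a, b). (snd (chart_at A h) a, snd c b)) `
    {(a, b). a \<in> fst (chart_at A h) \<and> b \<in> fst c \<and> mul a b \<in> fst d}"
  note W = mul_smooth_in_charts[OF chart_at_mem(1) cd, of h]
  let ?S = "snd c ` (fst c \<inter> mul h -` fst d)"
  have "smooth_on (\<lambda>u. (snd (chart_at A h) h, 0) + (0, u)) ?S"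
    by (intro smooth_on_add smooth_on_const bounded_linear_imp_smooth_on bounded_linear_Pair
        bounded_linear_zero bounded_linear_ident)
  then have "smooth_on (\<lambda>u. (snd (chart_at A h) h, u)) ?S" by simp
  from smooth_on_compose[OF orthonormal_basis_Times[OF B B] W(1) _ W(2) this]
  have "smooth_on (\<lambda>u. snd d (mul (chart_inv (chart_at A h) (snd (chart_at A h) h)) (chart_inv c u))) ?S"
    using cd by force
  then show "smooth_on (snd d \<circ> mul h \<circ> chart_inv c) ?S"
    by (simp add: comp_def)
qed

lemma left_mul_compose: "mul p \<circ> mul q = mul (mul p q)"
  by (simp add: fun_eq_iff grp.assoc)

lemma dL_eq: "dL A mul h p = chart_deriv (chart_at A p) (chart_at A (mul h p)) (mul h) p"
  by (simp add: dL_def tangent_map_eq)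

lemma linear_dL: "linear (dL A mul h p)"
  unfolding dL_eq by (rule linear_chart_deriv[OF smooth_map_left_mul]) simp_all

lemma dL_compose: "dL A mul h (mul k p) (dL A mul k p v) = dL A mul (mul h k) p v"
  using chart_deriv_compose[OF smooth_map_left_mul[of k] smooth_map_left_mul[of h]
      chart_at_mem(1)[of p] chart_at_mem(1)[of "mul k p"] chart_at_mem(1)[of "mul h (mul k p)"]]
  by (simp add: dL_eq left_mul_compose grp.assoc)

lemma dL_one: "dL A mul e p v = v"
proof -
  have "mul e = id" by (simp add: fun_eq_iff)
  then show ?thesis by (simp add: dL_eq chart_deriv_id_same)
qed

text \<open>Functoriality: translation by \<open>iv h\<close> undoes translation by
  \<open>h\<close>, so \<open>dL_compose\<close> and \<open>dL_one\<close> provide a two-sided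
  inverse.\<close>

lemma bij_dL: "bij (dL A mul h p)"
proof (rule o_bij)
  show "dL A mul (iv h) (mul h p) \<circ> dL A mul h p = id"
    by (simp add: fun_eq_iff dL_compose dL_one)
  have "dL A mul h (mul (iv h) (mul h p)) (dL A mul (iv h) (mul h p) v) = v" for v
    unfolding dL_compose by (simp add: dL_one)
  then show "dL A mul h p \<circ> dL A mul (iv h) (mul h p) = id"
    by (simp add: fun_eq_iff flip: grp.assoc)
qed

text \<open>The chosen chart at \<open>p\<close> cancels against the change to \<open>c\<close>.
  What remains involves only fixed charts and can be differentiated in \<open>p\<close>.\<close>

lemma local_rep_left_field:
  assumes "c \<in> A" "p \<in> fst c"
  shows "local_rep A c (left_field A mul e x) (snd c p) = chart_deriv (chart_at A e) c (mul p) e x"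
  using chart_deriv_compose[OF smooth_map_left_mul[of p] smooth_map_id chart_at_mem(1)[of e]
      chart_at_mem(1)[of p] assms(1)] assms
  by (simp add: local_rep_chart chart_change_eq left_field_def dL_eq)

text \<open>In charts the field is the partial derivative, in the second variable at
  \<open>e\<close> and direction \<open>x\<close>, of the jointly smooth multiplication
  \<open>?F\<close>. A directional derivative of a smooth map is smooth, and so is its restriction
  to the points \<open>(u, ?w)\<close>.\<close>

lemma vector_field_left_field: "vector_field A (left_field A mul e x)"
  unfolding vector_field_def
proof
  fix c assume c: "c \<in> A"
  obtain B :: "'b set" where B: "orthonormal_basis B" by (rule model_basis)
  let ?W = "(\<lambda>(a, b). (snd c a, snd (chart_at A e) b)) `
    {(a, b). a \<in> fst c \<and> b \<in> fst (chart_at A e) \<and> mul a b \<in> fst c}"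
  let ?F = "\<lambda>z. snd c (mul (chart_inv c (fst z)) (chart_inv (chart_at A e) (snd z)))"
  let ?w = "snd (chart_at A e) e"
  note W = mul_smooth_in_charts[OF c chart_at_mem(1) c, of e]
  let ?S = "snd c ` fst c"
  have "smooth_on (\<lambda>u. (u, 0) + (0, ?w)) ?S"
    by (intro smooth_on_add smooth_on_const bounded_linear_imp_smooth_on bounded_linear_Pair
        bounded_linear_zero bounded_linear_ident)
  then have pair: "smooth_on (\<lambda>u. (u, ?w)) ?S" by simp
  have mem: "(u, ?w) \<in> ?W" if "u \<in> ?S" for u using that by force
  have "smooth_on (\<lambda>u. frechet_derivative ?F (at (u, ?w)) (0, x)) ?S"
    by (rule smooth_on_compose[OF orthonormal_basis_Times[OF B B] W(1) _
          smooth_on_frechet_derivative[OF W] pair]) (use mem in blast)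
  moreover have "local_rep A c (left_field A mul e x) u = frechet_derivative ?F (at (u, ?w)) (0, x)"
    if u: "u \<in> ?S" for u
  proof -
    obtain p where p: "p \<in> fst c" "u = snd c p" using u by blast
    have "((\<lambda>w. (u, w)) has_derivative (\<lambda>v. (0, v))) (at ?w)"
      by (auto intro!: derivative_eq_intros)
    from has_derivative_compose[OF this smooth_on_has_derivative[OF W mem[OF u]]]
    have "((snd c \<circ> mul p \<circ> chart_inv (chart_at A e)) has_derivative
        (\<lambda>v. frechet_derivative ?F (at (u, ?w)) (0, v))) (at ?w)"
      using p c by (simp add: comp_def)
    then show ?thesis
      using p c by (simp add: local_rep_left_field chart_deriv_def frechet_derivative_at[symmetric])
  qed
  ultimately show "smooth_on (local_rep A c (left_field A mul e x)) ?S"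
    by (simp cong: smooth_on_cong)
qed

lemma has_derivative_local_rep:
  assumes "vector_field A X" "c \<in> A" "u \<in> snd c ` fst c"
  shows "(local_rep A c X has_derivative frechet_derivative (local_rep A c X) (at u)) (at u)"
  using assms smooth_on_has_derivative[OF chart_homeomorphism(2)[OF assms(2)] _ assms(3)]
  unfolding vector_field_def by blast

text \<open>Translation by \<open>p\<close> relates every left-invariant field to itself, so the
  bracket at \<open>e\<close> is carried to the bracket at \<open>p\<close>.\<close>

lemma lie_bracket_left_field:
  "lie_bracket A (left_field A mul e x) (left_field A mul e y) p = dL A mul p e (ad A mul e x y)"
proof -
  obtain B :: "'b set" where B: "orthonormal_basis B" by (rule model_basis)
  define c where "c = chart_at A e"
  define d where "d = chart_at A p"
  have c: "c \<in> A" "e \<in> fst c" and d: "d \<in> A" "p \<in> fst d" by (simp_all add: c_def d_def)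
  let ?f = "snd d \<circ> mul p \<circ> chart_inv c" and ?S = "snd c ` (fst c \<inter> mul p -` fst d)"
  let ?R = "\<lambda>c x. local_rep A c (left_field A mul e x)"
  have S: "open ?S" "snd c e \<in> ?S" using open_vimage_chart[OF smooth_map_left_mul c(1) d(1)] c d by auto
  have f: "Ck_on 2 ?f ?S"
    using smooth_map_smooth_on[OF smooth_map_left_mul c(1) d(1)] smooth_on_open[OF S(1)] by blast
  have fu: "?f (snd c e) = snd d p" using c by simp
  \<comment> \<open>Self-relatedness in charts: translation by \<open>mul p q\<close> is translation
    by \<open>q\<close> followed by translation by \<open>p\<close>, and the chain rule splits its
    derivative.\<close>
  have rel: "?R d x (?f u) = frechet_derivative ?f (at u) (?R c x u)" if u: "u \<in> ?S" for u x
  proof -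
    obtain q where q: "q \<in> fst c" "mul p q \<in> fst d" "u = snd c q" using u by auto
    have "?R d x (?f u) = chart_deriv c d (mul (mul p q)) e x"
      using q c d by (simp add: local_rep_left_field c_def)
    also have "\<dots> = chart_deriv c d (mul p) q (chart_deriv c c (mul q) e x)"
      using chart_deriv_compose[OF smooth_map_left_mul[of q] smooth_map_left_mul[of p] c(1) c(1) d(1) c(2)] q
      by (simp add: left_mul_compose)
    also have "\<dots> = frechet_derivative ?f (at u) (?R c x u)"
      using q c by (simp add: local_rep_left_field chart_deriv_def[of c d "mul p" q] flip: c_def)
    finally show ?thesis .
  qed
  have der_c: "(?R c x has_derivative frechet_derivative (?R c x) (at (snd c e))) (at (snd c e))" for x
    by (rule has_derivative_local_rep[OF vector_field_left_field]) (use c in auto)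
  have der_d: "(?R d x has_derivative frechet_derivative (?R d x) (at (snd d p))) (at (?f (snd c e)))" for x
    unfolding fu by (rule has_derivative_local_rep[OF vector_field_left_field]) (use d in auto)
  have "frechet_derivative (?R d y) (at (snd d p)) (?R d x (snd d p))
      - frechet_derivative (?R d x) (at (snd d p)) (?R d y (snd d p))
    = frechet_derivative ?f (at (snd c e)) (frechet_derivative (?R c y) (at (snd c e)) (?R c x (snd c e))
      - frechet_derivative (?R c x) (at (snd c e)) (?R c y (snd c e)))"
    using lie_bracket_related[OF B S f der_c der_c der_d der_d rel rel] unfolding fu .
  then show ?thesis
    by (simp add: lie_bracket_def ad_def Let_def dL_eq chart_deriv_def c_def d_def)
qed

end

section \<open>The Levi-Civita connection on left-invariant fields\<close>

locale left_invariant_levi_civita = lie_manifold A mul e iv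
  for A :: "('a::{t2_space,second_countable_topology}, 'b::real_inner) atlas"
    and mul :: "'a \<Rightarrow> 'a \<Rightarrow> 'a" and e :: 'a and iv :: "'a \<Rightarrow> 'a" +
  fixes g :: "'a \<Rightarrow> 'b \<Rightarrow> 'b \<Rightarrow> real"
    and nabla :: "('a \<Rightarrow> 'b) \<Rightarrow> ('a \<Rightarrow> 'b) \<Rightarrow> 'a \<Rightarrow> 'b"
  assumes metric: "riemannian_metric A g"
    and left_invariant: "left_invariant_metric A mul g"
    and levi_civita: "levi_civita A g nabla"
begin

abbreviation lf :: "'b \<Rightarrow> 'a \<Rightarrow> 'b" where
  "lf \<equiv> left_field A mul e"

abbreviation ad' :: "'b \<Rightarrow> 'b \<Rightarrow> 'b" where
  "ad' \<equiv> ad A mul e"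

lemma metric_bilinear: "bilinear (g p)"
  and metric_sym: "g p v w = g p w v"
  and metric_pos: "v \<noteq> 0 \<Longrightarrow> g p v v > 0"
  using metric unfolding riemannian_metric_def by blast+

lemma metric_nondegenerate:
  assumes "\<And>c. g p v c = g p w c"
  shows "v = w"
proof (rule ccontr)
  assume "v \<noteq> w"
  then have "g p (v - w) (v - w) > 0" using metric_pos by simp
  then show False using assms by (simp add: bilinear_lsub[OF metric_bilinear])
qed

lemma metric_left_field: "g p (lf x p) (lf y p) = g e x y"
proof -
  have "g e x y = g (mul p e) (dL A mul p e x) (dL A mul p e y)"
    using left_invariant unfolding left_invariant_metric_def by blast
  then show ?thesis by (simp add: left_field_def)
qed

lemma linear_metric: "linear (g p v)" "linear (\<lambda>v. g p v w)"
  using metric_bilinear[of p] by (simp_all add: bilinear_def)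

text \<open>\<open>T\<close> is the Gram operator of the metric with respect to the model inner
  product, characterized by \<open>T d \<bullet> c = g p d c\<close>. Positivity makes it injective,
  and finite dimension does the rest.\<close>

lemma gram_map:
  fixes B :: "'b set" and p :: 'a
  assumes B: "orthonormal_basis B"
  defines "T \<equiv> \<lambda>d. \<Sum>b\<in>B. g p d b *\<^sub>R b"
  shows "linear T" "bij T"
proof -
  show lin: "linear T"
    unfolding T_def
    by (rule linearI)
      (simp_all add: bilinear_ladd[OF metric_bilinear] bilinear_lmul[OF metric_bilinear]
        scaleR_add_left sum.distrib scaleR_sum_right)
  have "d = 0" if d: "T d = 0" for d
  proof -
    have "T d \<bullet> d = (\<Sum>b\<in>B. (d \<bullet> b) *\<^sub>R g p d b)"
      unfolding T_def inner_sum_left by (simp add: inner_commute mult.commute)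
    also have "\<dots> = g p d d"
      using orthonormal_basis_linear_expand[OF B linear_metric(1), of p d d] by simp
    finally show "d = 0" using d metric_pos[of d p] by fastforce
  qed
  then have "inj T" using linear_injective_0[OF lin] by blast
  then show "bij T" using orthonormal_basis_linear_inj_imp_surj[OF B lin] by (simp add: bij_def)
qed

text \<open>Riesz representation for \<open>g p\<close>: existence from surjectivity of the Gram
  operator, uniqueness from nondegeneracy. It justifies the description that defines
  \<open>ad_star\<close>.\<close>

lemma metric_riesz:
  fixes \<phi> :: "'b \<Rightarrow> real"
  assumes "linear \<phi>"
  shows "\<exists>!d. \<forall>c. g p d c = \<phi> c"
proof -
  obtain B :: "'b set" where B: "orthonormal_basis B" by (rule model_basis)
  let ?T = "\<lambda>d. \<Sum>b\<in>B. g p d b *\<^sub>R b"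
  have "surj ?T" using gram_map(2)[OF B] by (rule bij_is_surj)
  then obtain d where d: "(\<Sum>b\<in>B. \<phi> b *\<^sub>R b) = ?T d" by (rule surjE)
  have "g p d b = \<phi> b" if "b \<in> B" for b
    using arg_cong[OF d, of "\<lambda>v. v \<bullet> b"] by (simp add: orthonormal_basis_sum_inner[OF B that])
  then have "g p d c = \<phi> c" for c
    using orthonormal_basis_linear_expand[OF B linear_metric(1), of p d c]
      orthonormal_basis_linear_expand[OF B assms, of c] by simp
  then show ?thesis by (intro ex1I[of _ d]) (auto intro: metric_nondegenerate[of p])
qed

lemma left_field_add: "lf (x + y) = (\<lambda>p. lf x p + lf y p)"
  and left_field_scaleR: "lf (k *\<^sub>R x) = (\<lambda>p. k *\<^sub>R lf x p)"
  by (simp_all add: fun_eq_iff left_field_def linear_add[OF linear_dL] linear_scale[OF linear_dL])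

lemma connection: "affine_connection A nabla"
  using levi_civita by (simp add: levi_civita_def)

lemma nabla_linear_direction:
  assumes "vector_field A Y"
  shows "linear (\<lambda>x. nabla (lf x) Y p)"
proof (rule linearI)
  have "\<forall>X X' Y p. vector_field A X \<and> vector_field A X' \<and> vector_field A Y \<longrightarrow>
      nabla (\<lambda>q. X q + X' q) Y p = nabla X Y p + nabla X' Y p"
    using connection unfolding affine_connection_def by blast
  then show "nabla (lf (x + y)) Y p = nabla (lf x) Y p + nabla (lf y) Y p" for x y
    unfolding left_field_add using assms vector_field_left_field by simp
  have "nabla (\<lambda>q. k *\<^sub>R X q) Y p = k *\<^sub>R nabla X Y p" if "vector_field A X" for k X
  proof -
    have "\<forall>f X Y p. smooth_fun A f \<and> vector_field A X \<and> vector_field A Y \<longrightarrow>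
        nabla (\<lambda>q. f q *\<^sub>R X q) Y p = f p *\<^sub>R nabla X Y p"
      using connection unfolding affine_connection_def by blast
    from this[rule_format, of "\<lambda>_. k" X Y p] show ?thesis
      using that assms smooth_fun_const by simp
  qed
  then show "nabla (lf (k *\<^sub>R x)) Y p = k *\<^sub>R nabla (lf x) Y p" for k x
    using vector_field_left_field unfolding left_field_scaleR by simp
qed

lemma nabla_linear_left_field:
  assumes "vector_field A X"
  shows "linear (\<lambda>y. nabla X (lf y) p)"
proof (rule linearI)
  have "\<forall>X Y Y' p. vector_field A X \<and> vector_field A Y \<and> vector_field A Y' \<longrightarrow>
      nabla X (\<lambda>q. Y q + Y' q) p = nabla X Y p + nabla X Y' p"
    using connection unfolding affine_connection_def by blast
  then show "nabla X (lf (x + y)) p = nabla X (lf x) p + nabla X (lf y) p" for x y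
    unfolding left_field_add using assms vector_field_left_field by simp
  have "nabla X (\<lambda>q. k *\<^sub>R Y q) p = k *\<^sub>R nabla X Y p" if "vector_field A Y" for k Y
  proof -
    have "\<forall>f X Y p. smooth_fun A f \<and> vector_field A X \<and> vector_field A Y \<longrightarrow>
        nabla X (\<lambda>q. f q *\<^sub>R Y q) p = dir_deriv A f p (X p) *\<^sub>R Y p + f p *\<^sub>R nabla X Y p"
      using connection unfolding affine_connection_def by blast
    \<comment> \<open>For a constant factor the directional derivative vanishes, so the Leibniz rule
      reduces to homogeneity.\<close>
    from this[rule_format, of "\<lambda>_. k" X Y p] show ?thesis
      using that assms smooth_fun_const by (simp add: dir_deriv_const)
  qed
  then show "nabla X (lf (k *\<^sub>R x)) p = k *\<^sub>R nabla X (lf x) p" for k x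
    using vector_field_left_field unfolding left_field_scaleR by simp
qed

lemma torsion_free: "nabla (lf x) (lf y) p - nabla (lf y) (lf x) p = lf (ad' x y) p"
proof -
  have "nabla (lf x) (lf y) p - nabla (lf y) (lf x) p = lie_bracket A (lf x) (lf y) p"
    using levi_civita vector_field_left_field unfolding levi_civita_def by blast
  then show ?thesis unfolding lie_bracket_left_field by (simp add: left_field_def)
qed

lemma metric_compatible:
  "g p (nabla (lf x) (lf y) p) (lf z p) + g p (lf y p) (nabla (lf x) (lf z) p) = 0"
proof -
  have "dir_deriv A (\<lambda>q. g q (lf y q) (lf z q)) p (lf x p)
      = g p (nabla (lf x) (lf y) p) (lf z p) + g p (lf y p) (nabla (lf x) (lf z) p)"
    using levi_civita vector_field_left_field unfolding levi_civita_def by blast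
  then show ?thesis by (simp add: metric_left_field dir_deriv_const)
qed

lemma left_field_one: "lf x e = x"
  by (simp add: left_field_def dL_one)

text \<open>Torsion-freeness at \<open>e\<close> writes the bracket as a difference of two covariant
  derivatives that are linear in \<open>y\<close>, so no coordinate computation is required.\<close>

lemma linear_ad: "linear (ad' x)"
proof -
  have "ad' x = (\<lambda>y. nabla (lf x) (lf y) e - nabla (lf y) (lf x) e)"
    by (simp add: fun_eq_iff torsion_free left_field_one)
  then show ?thesis
    using nabla_linear_direction nabla_linear_left_field vector_field_left_field
    by (simp add: linear_compose_sub)
qed

lemma ad_star: "g e (ad_star A mul e g a b) c = g e b (ad' a c)"
proof -
  have "linear (\<lambda>c. g e b (ad' a c))"
    using linear_compose[OF linear_ad linear_metric(1)] by (simp add: comp_def)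
  from theI'[OF metric_riesz[OF this]] show ?thesis unfolding ad_star_def by blast
qed

lemma metric_alpha:
  "2 * g e (alpha A mul e g x y) z = g e (ad' x y) z - g e y (ad' x z) - g e x (ad' y z)"
  by (simp add: alpha_def bilinear_lmul[OF metric_bilinear] bilinear_lsub[OF metric_bilinear] ad_star)

text \<open>Koszul's formula, in which the three derivative terms vanish because the inner product
  of two left-invariant fields is constant.\<close>

lemma nabla_left_field: "nabla (lf x) (lf y) p = lf (alpha A mul e g x y) p"
proof (rule metric_nondegenerate)
  fix c
  obtain z where c: "c = lf z p" using bij_dL[of p e] unfolding left_field_def by (metis bij_pointE)
  let ?n = "\<lambda>x y. nabla (lf x) (lf y) p"
  have ad: "g p (?n x y) (lf z p) - g p (?n y x) (lf z p) = g e (ad' x y) z" for x y z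
    using arg_cong[OF torsion_free[of x y p], of "\<lambda>v. g p v (lf z p)"]
    by (simp add: bilinear_lsub[OF metric_bilinear] metric_left_field)
  have comp: "g p (?n x y) (lf z p) + g p (?n x z) (lf y p) = 0" for x y z
    using metric_compatible[of p x y z] by (simp add: metric_sym)
  have "2 * g p (?n x y) (lf z p) = g e (ad' x y) z - g e (ad' x z) y - g e (ad' y z) x"
    using ad[of x y z] ad[of x z y] ad[of y z x] comp[of x y z] comp[of y x z] comp[of z x y]
    by linarith
  also have "\<dots> = 2 * g e (alpha A mul e g x y) z"
    unfolding metric_alpha by (simp add: metric_sym)
  finally show "g p (?n x y) c = g p (lf (alpha A mul e g x y) p) c"
    by (simp add: c metric_left_field)
qed

text \<open>In \<open>ad_star y x\<close> the variable \<open>y\<close> enters through the map whose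
  adjoint is taken; linearity is instead inherited from the connection at \<open>e\<close>.\<close>

lemma linear_alpha: "linear (alpha A mul e g x)"
proof -
  have "alpha A mul e g x = (\<lambda>y. nabla (lf x) (lf y) e)"
    by (simp add: fun_eq_iff nabla_left_field left_field_one)
  then show ?thesis using nabla_linear_left_field vector_field_left_field by simp
qed

end

section \<open>Fields along a curve\<close>

context manifold
begin

lemma field_along_vector_field:
  assumes "smooth_curve A I \<gamma>" "vector_field A X"
  shows "field_along A I \<gamma> (\<lambda>t. X (\<gamma> t))"
  unfolding field_along_def
proof
  fix c assume c: "c \<in> A"
  obtain B :: "'b set" where B: "orthonormal_basis B" by (rule model_basis)
  let ?J = "I \<inter> \<gamma> -` fst c"
  have "smooth_on (\<lambda>t. local_rep A c X ((snd c \<circ> \<gamma>) t)) ?J"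
  proof (rule smooth_on_compose[OF B chart_homeomorphism(2)[OF c],
        where h = "snd c \<circ> \<gamma>" and f = "local_rep A c X"])
    show "smooth_on (snd c \<circ> \<gamma>) ?J" using assms(1) c by (simp add: smooth_curve_def)
    show "smooth_on (local_rep A c X) (snd c ` fst c)"
      using assms(2) c by (simp add: vector_field_def)
  qed auto
  then show "smooth_on (\<lambda>t. chart_change (chart_at A (\<gamma> t)) c (\<gamma> t) (X (\<gamma> t))) ?J"
    by (rule smooth_on_cong[THEN iffD1, rotated]) (use c in \<open>simp add: local_rep_chart\<close>)
qed

lemma field_along_zero: "field_along A I \<gamma> (\<lambda>t. 0)"
  unfolding field_along_def
proof
  fix c assume c: "c \<in> A"
  show "smooth_on (\<lambda>t. chart_change (chart_at A (\<gamma> t)) c (\<gamma> t) 0) (I \<inter> \<gamma> -` fst c)"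
    by (rule smooth_on_cong[THEN iffD1, rotated, OF smooth_on_const[of 0]])
      (use c linear_0[OF linear_chart_change[OF chart_at_mem(1) c chart_at_mem(2)]] in simp)
qed

lemma field_along_add:
  assumes "field_along A I \<gamma> V" "field_along A I \<gamma> W"
  shows "field_along A I \<gamma> (\<lambda>t. V t + W t)"
  unfolding field_along_def
proof
  fix c assume c: "c \<in> A"
  let ?C = "\<lambda>t. chart_change (chart_at A (\<gamma> t)) c (\<gamma> t)"
  have "smooth_on (\<lambda>t. ?C t (V t) + ?C t (W t)) (I \<inter> \<gamma> -` fst c)"
    using assms c unfolding field_along_def by (intro smooth_on_add) blast+
  then show "smooth_on (\<lambda>t. ?C t (V t + W t)) (I \<inter> \<gamma> -` fst c)"
    by (rule smooth_on_cong[THEN iffD1, rotated])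
      (use c linear_add[OF linear_chart_change[OF chart_at_mem(1) c chart_at_mem(2)]] in simp)
qed

lemma field_along_scaleR:
  assumes "smooth_on f I" "field_along A I \<gamma> V"
  shows "field_along A I \<gamma> (\<lambda>t. f t *\<^sub>R V t)"
  unfolding field_along_def
proof
  fix c assume c: "c \<in> A"
  let ?C = "\<lambda>t. chart_change (chart_at A (\<gamma> t)) c (\<gamma> t)"
  have "smooth_on (\<lambda>t. f t *\<^sub>R ?C t (V t)) (I \<inter> \<gamma> -` fst c)"
    using assms c smooth_on_subset[of f I] unfolding field_along_def
    by (intro smooth_on_scaleR) auto
  then show "smooth_on (\<lambda>t. ?C t (f t *\<^sub>R V t)) (I \<inter> \<gamma> -` fst c)"
    by (rule smooth_on_cong[THEN iffD1, rotated])
      (use c linear_scale[OF linear_chart_change[OF chart_at_mem(1) c chart_at_mem(2)]] in simp)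
qed

lemma field_along_sum:
  assumes "\<And>i. i \<in> F \<Longrightarrow> field_along A I \<gamma> (V i)"
  shows "field_along A I \<gamma> (\<lambda>t. \<Sum>i\<in>F. V i t)"
  using assms
  by (induction F rule: infinite_finite_induct) (simp_all add: field_along_zero field_along_add)

text \<open>Smoothness of the metric is given only for fixed component vectors in a fixed chart.
  Near each time both fields are therefore expanded over \<open>B\<close> in one chart, which leaves
  products of smooth coefficients with metric components along the curve.\<close>

lemma smooth_on_metric_along:
  assumes g: "riemannian_metric A g" and \<gamma>: "smooth_curve A I \<gamma>"
    and V: "field_along A I \<gamma> V" and W: "field_along A I \<gamma> W"
  shows "smooth_on (\<lambda>t. g (\<gamma> t) (V t) (W t)) I"
proof (rule smooth_on_local)
  fix s assume s: "s \<in> I"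
  define c where "c = chart_at A (\<gamma> s)"
  have c: "c \<in> A" "\<gamma> s \<in> fst c" by (simp_all add: c_def)
  obtain B :: "'b set" where B: "orthonormal_basis B" by (rule model_basis)
  have "continuous_on I \<gamma>" using \<gamma> by (simp add: smooth_curve_def)
  \<comment> \<open>The times at which the curve lies in the chart form only a relatively open
    subset of \<open>I\<close>; \<open>U\<close> is an open set of reals cutting it out.\<close>
  then obtain U where U: "open U" "U \<inter> I = \<gamma> -` fst c \<inter> I"
    using chart_homeomorphism(1)[OF c(1)] by (metis continuous_on_open_invariant)
  let ?J = "I \<inter> \<gamma> -` fst c"
  let ?C = "\<lambda>t. chart_change (chart_at A (\<gamma> t)) c (\<gamma> t)"
  let ?C' = "\<lambda>p. chart_change c (chart_at A p) p"
  let ?G = "\<lambda>b b' u. let p = chart_inv c u in g p (?C' p b) (?C' p b')"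
  have "smooth_on (?G b b') (snd c ` fst c)" for b b'
    using g c(1) unfolding riemannian_metric_def by blast
  moreover have "smooth_on (snd c \<circ> \<gamma>) ?J" using \<gamma> c(1) by (simp add: smooth_curve_def)
  ultimately have G: "smooth_on (\<lambda>t. ?G b b' ((snd c \<circ> \<gamma>) t)) ?J" for b b'
    by (intro smooth_on_compose[OF B chart_homeomorphism(2)[OF c(1)],
          where h = "snd c \<circ> \<gamma>" and f = "?G b b'"]) auto
  have "smooth_on (\<lambda>t. ?C t (V t)) ?J" "smooth_on (\<lambda>t. ?C t (W t)) ?J"
    using V W c(1) unfolding field_along_def by blast+
  then have smooth: "smooth_on (\<lambda>t. \<Sum>b\<in>B. (?C t (V t) \<bullet> b) *\<^sub>R (\<Sum>b'\<in>B. (?C t (W t) \<bullet> b') *\<^sub>R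
      ?G b b' ((snd c \<circ> \<gamma>) t))) ?J"
    by (intro smooth_on_sum smooth_on_scaleR G smooth_on_bounded_linear[OF bounded_linear_inner_left])
  have "(\<Sum>b\<in>B. (?C t (V t) \<bullet> b) *\<^sub>R (\<Sum>b'\<in>B. (?C t (W t) \<bullet> b') *\<^sub>R
      ?G b b' ((snd c \<circ> \<gamma>) t))) = g (\<gamma> t) (V t) (W t)" if t: "t \<in> ?J" for t
  proof -
    let ?p = "\<gamma> t"
    have bil: "bilinear (g ?p)" using g by (simp add: riemannian_metric_def)
    have lin: "linear (?C' ?p)" using linear_chart_change c(1) t by simp
    have l1: "linear (\<lambda>w. g ?p v (?C' ?p w))" for v
      using linear_compose[OF lin, of "g ?p v"] bil by (simp add: bilinear_def comp_def)
    have l2: "linear (\<lambda>v. g ?p (?C' ?p v) w)" for w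
      using linear_compose[OF lin, of "\<lambda>v. g ?p v w"] bil by (simp add: bilinear_def comp_def)
    have "g ?p (V t) (W t) = g ?p (?C' ?p (?C t (V t))) (?C' ?p (?C t (W t)))"
      using chart_change_inverse[OF chart_at_mem(1) c(1) chart_at_mem(2)] t by simp
    also have "\<dots> = (\<Sum>b\<in>B. (?C t (V t) \<bullet> b) *\<^sub>R g ?p (?C' ?p b) (?C' ?p (?C t (W t))))"
      by (rule orthonormal_basis_linear_expand[OF B l2])
    also have "\<dots> = (\<Sum>b\<in>B. (?C t (V t) \<bullet> b) *\<^sub>R (\<Sum>b'\<in>B. (?C t (W t) \<bullet> b') *\<^sub>R
        g ?p (?C' ?p b) (?C' ?p b')))"
      by (subst orthonormal_basis_linear_expand[OF B l1]) (rule refl)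
    finally show ?thesis using c(1) t by (simp add: Let_def)
  qed
  from smooth_on_cong[OF this] smooth have "smooth_on (\<lambda>t. g (\<gamma> t) (V t) (W t)) ?J"
    by (rule iffD1)
  moreover have "I \<inter> U = ?J" using U by blast
  moreover have "s \<in> U" using U s c(2) by blast
  ultimately show "\<exists>U. open U \<and> s \<in> U \<and> smooth_on (\<lambda>t. g (\<gamma> t) (V t) (W t)) (I \<inter> U)"
    using U(1) by metis
qed

lemma covariant_derivative_along_sum:
  assumes D: "covariant_derivative_along A nabla I \<gamma> D" and "finite F"
    and V: "\<And>i. i \<in> F \<Longrightarrow> field_along A I \<gamma> (V i)" and "t \<in> I"
  shows "D (\<lambda>s. \<Sum>i\<in>F. V i s) t = (\<Sum>i\<in>F. D (V i) t)"
  using assms(2) V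
proof (induction F)
  case empty
  have "\<forall>f V. smooth_on f I \<and> field_along A I \<gamma> V \<longrightarrow>
      (\<forall>t\<in>I. D (\<lambda>s. f s *\<^sub>R V s) t =
        vector_derivative f (at t within I) *\<^sub>R V t + f t *\<^sub>R D V t)"
    using D unfolding covariant_derivative_along_def by blast
  \<comment> \<open>The empty sum is the zero field: the Leibniz rule with zero factor and zero
    field makes both terms vanish.\<close>
  from this[rule_format, OF conjI[OF smooth_on_const[of 0] field_along_zero] \<open>t \<in> I\<close>]
  show ?case by simp
next
  case (insert i F)
  have "\<forall>V W. field_along A I \<gamma> V \<and> field_along A I \<gamma> W \<longrightarrow>
      (\<forall>t\<in>I. D (\<lambda>s. V s + W s) t = D V t + D W t)"
    using D unfolding covariant_derivative_along_def by blast
  moreover have "field_along A I \<gamma> (V i)" "field_along A I \<gamma> (\<lambda>s. \<Sum>i\<in>F. V i s)"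
    using insert.prems field_along_sum[of F I \<gamma> V] by simp_all
  ultimately have "D (\<lambda>s. V i s + (\<Sum>i\<in>F. V i s)) t = D (V i) t + D (\<lambda>s. \<Sum>i\<in>F. V i s) t"
    using \<open>t \<in> I\<close> by simp
  then show ?case using insert by simp
qed

end

section \<open>Covariant derivatives in the left trivialization\<close>

context left_invariant_levi_civita
begin

text \<open>By left-invariance the numbers \<open>g (\<gamma> t) (Y t) (lf b (\<gamma> t))\<close>
  are the Gram data of \<zeta> for the metric at \<open>e\<close>. One linear left inverse
  \<open>S\<close> of the Gram operator at \<open>e\<close> thus recovers \<zeta> at every time, and
  the pairings are smooth.\<close>

lemma smooth_on_left_trivialization:
  assumes \<gamma>: "smooth_curve A I \<gamma>" and Y: "field_along A I \<gamma> Y"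
  shows "smooth_on (\<lambda>t. inv (dL A mul (\<gamma> t) e) (Y t)) I"
proof -
  obtain B :: "'b set" where B: "orthonormal_basis B" by (rule model_basis)
  let ?T = "\<lambda>d. \<Sum>b\<in>B. g e d b *\<^sub>R b"
  let ?\<zeta> = "\<lambda>t. inv (dL A mul (\<gamma> t) e) (Y t)"
  obtain S where S: "linear S" "S \<circ> ?T = id"
    using linear_injective_left_inverse[OF gram_map(1)[OF B, of e] bij_is_inj[OF gram_map(2)[OF B, of e]]]
    by (elim exE conjE)
  have "smooth_on (\<lambda>t. \<Sum>b\<in>B. g (\<gamma> t) (Y t) (lf b (\<gamma> t)) *\<^sub>R b) I"
    by (intro smooth_on_sum smooth_on_scaleR smooth_on_const smooth_on_metric_along[OF metric \<gamma> Y]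
        field_along_vector_field[OF \<gamma> vector_field_left_field])
  then have "smooth_on (\<lambda>t. S (\<Sum>b\<in>B. g (\<gamma> t) (Y t) (lf b (\<gamma> t)) *\<^sub>R b)) I"
    by (rule smooth_on_bounded_linear[OF orthonormal_basis_linear_imp_bounded_linear[OF B S(1)]])
  moreover have "S (\<Sum>b\<in>B. g (\<gamma> t) (Y t) (lf b (\<gamma> t)) *\<^sub>R b) = ?\<zeta> t" for t
  proof -
    have "Y t = lf (?\<zeta> t) (\<gamma> t)"
      using bij_dL[of "\<gamma> t" e] by (simp add: left_field_def bij_is_surj surj_f_inv_f)
    then have "g (\<gamma> t) (Y t) (lf b (\<gamma> t)) = g e (?\<zeta> t) b" for b by (metis metric_left_field)
    then have "S (\<Sum>b\<in>B. g (\<gamma> t) (Y t) (lf b (\<gamma> t)) *\<^sub>R b) = (S \<circ> ?T) (?\<zeta> t)" by simp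
    then show ?thesis using S(2) by simp
  qed
  ultimately show ?thesis by simp
qed

lemma covariant_derivative_left_trivialization:
  fixes \<gamma> :: "real \<Rightarrow> 'a" and Y :: "real \<Rightarrow> 'b"
  assumes \<gamma>: "smooth_curve A I \<gamma>" and Y: "field_along A I \<gamma> Y"
    and D: "covariant_derivative_along A nabla I \<gamma> D"
    and t: "t \<in> I" and nontriv: "at t within I \<noteq> bot"
  defines "\<omega> \<equiv> inv (dL A mul (\<gamma> t) e) (velocity A I \<gamma> t)"
    and "\<zeta> \<equiv> \<lambda>t. inv (dL A mul (\<gamma> t) e) (Y t)"
  shows "\<exists>\<zeta>'. (\<zeta> has_vector_derivative \<zeta>') (at t within I) \<and>
    D Y t = dL A mul (\<gamma> t) e (\<zeta>' + alpha A mul e g \<omega> (\<zeta> t))"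
proof -
  obtain B :: "'b set" where B: "orthonormal_basis B" by (rule model_basis)
  have fin: "finite B" using B by (simp add: orthonormal_basis_def)
  have smooth: "smooth_on \<zeta> I" unfolding \<zeta>_def by (rule smooth_on_left_trivialization[OF \<gamma> Y])
  define \<zeta>' where "\<zeta>' = vector_derivative \<zeta> (at t within I)"
  have der: "(\<zeta> has_vector_derivative \<zeta>') (at t within I)"
    using smooth_on_differentiable[OF smooth t] unfolding \<zeta>'_def vector_derivative_works .
  \<comment> \<open>The Leibniz clause uses the description \<open>vector_derivative\<close>; it has
    the intended value only where derivatives within \<open>I\<close> are unique, which
    \<open>nontriv\<close> ensures.\<close>
  have der_b: "vector_derivative (\<lambda>s. \<zeta> s \<bullet> b) (at t within I) = \<zeta>' \<bullet> b" for b
    by (rule vector_derivative_within[OF nontriv])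
      (rule bounded_linear.has_vector_derivative[OF bounded_linear_inner_left der])
  have smooth_b: "smooth_on (\<lambda>s. \<zeta> s \<bullet> b) I" for b
    by (rule smooth_on_bounded_linear[OF bounded_linear_inner_left smooth])
  have along: "field_along A I \<gamma> (\<lambda>s. lf b (\<gamma> s))" for b
    by (rule field_along_vector_field[OF \<gamma> vector_field_left_field])
  have expand: "dL A mul p e v = (\<Sum>b\<in>B. (v \<bullet> b) *\<^sub>R lf b p)" for p v
    unfolding left_field_def by (rule orthonormal_basis_linear_expand[OF B linear_dL])
  have "Y = (\<lambda>s. \<Sum>b\<in>B. (\<zeta> s \<bullet> b) *\<^sub>R lf b (\<gamma> s))"
    unfolding expand[symmetric] \<zeta>_def
    by (simp add: fun_eq_iff surj_f_inv_f[OF bij_is_surj[OF bij_dL]])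
  then have "D Y t = (\<Sum>b\<in>B. D (\<lambda>s. (\<zeta> s \<bullet> b) *\<^sub>R lf b (\<gamma> s)) t)"
    using covariant_derivative_along_sum[OF D fin _ t, of "\<lambda>b s. (\<zeta> s \<bullet> b) *\<^sub>R lf b (\<gamma> s)"]
      field_along_scaleR[OF smooth_b along] by simp
  also have "\<dots> = (\<Sum>b\<in>B. (\<zeta>' \<bullet> b) *\<^sub>R lf b (\<gamma> t)
      + (\<zeta> t \<bullet> b) *\<^sub>R lf (alpha A mul e g \<omega> b) (\<gamma> t))"
  proof (rule sum.cong[OF refl])
    fix b
    have "\<forall>f V. smooth_on f I \<and> field_along A I \<gamma> V \<longrightarrow>
        (\<forall>t\<in>I. D (\<lambda>s. f s *\<^sub>R V s) t =
                 vector_derivative f (at t within I) *\<^sub>R V t + f t *\<^sub>R D V t)"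
      using D unfolding covariant_derivative_along_def by blast
    from this[rule_format, OF conjI[OF smooth_b along] t]
    have "D (\<lambda>s. (\<zeta> s \<bullet> b) *\<^sub>R lf b (\<gamma> s)) t
        = (\<zeta>' \<bullet> b) *\<^sub>R lf b (\<gamma> t) + (\<zeta> t \<bullet> b) *\<^sub>R D (\<lambda>s. lf b (\<gamma> s)) t"
      by (simp only: der_b)
    moreover have "D (\<lambda>s. lf b (\<gamma> s)) t = nabla (lf \<omega>) (lf b) (\<gamma> t)"
    proof -
      have "\<forall>V X. field_along A I \<gamma> V \<and> vector_field A X \<and> (\<forall>t\<in>I. V t = X (\<gamma> t)) \<longrightarrow>
          (\<forall>t\<in>I. \<forall>W. vector_field A W \<and> W (\<gamma> t) = velocity A I \<gamma> t \<longrightarrow> D V t = nabla W X (\<gamma> t))"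
        using D unfolding covariant_derivative_along_def by blast
      \<comment> \<open>\<omega> is a single vector belonging to the fixed time \<open>t\<close>, so
        \<open>lf \<omega>\<close> is a field on the whole group that meets the velocity at this one
        point.\<close>
      moreover have "lf \<omega> (\<gamma> t) = velocity A I \<gamma> t"
        by (simp add: left_field_def \<omega>_def surj_f_inv_f[OF bij_is_surj[OF bij_dL]])
      ultimately show ?thesis using along vector_field_left_field t by simp
    qed
    ultimately show "D (\<lambda>s. (\<zeta> s \<bullet> b) *\<^sub>R lf b (\<gamma> s)) t
        = (\<zeta>' \<bullet> b) *\<^sub>R lf b (\<gamma> t) + (\<zeta> t \<bullet> b) *\<^sub>R lf (alpha A mul e g \<omega> b) (\<gamma> t)"
      by (simp add: nabla_left_field)
  qed
  also have "\<dots> = dL A mul (\<gamma> t) e \<zeta>' + dL A mul (\<gamma> t) e (\<Sum>b\<in>B. (\<zeta> t \<bullet> b) *\<^sub>R alpha A mul e g \<omega> b)"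
    by (simp add: sum.distrib expand[of _ \<zeta>'] linear_sum[OF linear_dL] linear_scale[OF linear_dL]
        left_field_def)
  also have "\<dots> = dL A mul (\<gamma> t) e (\<zeta>' + alpha A mul e g \<omega> (\<zeta> t))"
    using orthonormal_basis_linear_expand[OF B linear_alpha, of \<omega> "\<zeta> t"]
    by (simp add: linear_add[OF linear_dL])
  finally show ?thesis using der by blast
qed

lemma parallel_iff:
  fixes \<gamma> :: "real \<Rightarrow> 'a" and Y :: "real \<Rightarrow> 'b"
  assumes \<gamma>: "smooth_curve A I \<gamma>" and Y: "field_along A I \<gamma> Y"
    and D: "covariant_derivative_along A nabla I \<gamma> D"
    and t: "t \<in> I" and nontriv: "at t within I \<noteq> bot"
  defines "\<omega> \<equiv> \<lambda>t. inv (dL A mul (\<gamma> t) e) (velocity A I \<gamma> t)"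
    and "\<zeta> \<equiv> \<lambda>t. inv (dL A mul (\<gamma> t) e) (Y t)"
  shows "D Y t = 0 \<longleftrightarrow>
    (\<zeta> has_vector_derivative - alpha A mul e g (\<omega> t) (\<zeta> t)) (at t within I)"
proof -
  obtain \<zeta>' where der: "(\<zeta> has_vector_derivative \<zeta>') (at t within I)"
    and DY: "D Y t = dL A mul (\<gamma> t) e (\<zeta>' + alpha A mul e g (\<omega> t) (\<zeta> t))"
    using covariant_derivative_left_trivialization[OF \<gamma> Y D t nontriv] unfolding \<omega>_def \<zeta>_def by blast
  have "D Y t = 0 \<longleftrightarrow> \<zeta>' + alpha A mul e g (\<omega> t) (\<zeta> t) = 0"
    unfolding DY using linear_injective_0[OF linear_dL] bij_is_inj[OF bij_dL]
      linear_0[OF linear_dL] by metis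
  also have "\<dots> \<longleftrightarrow> \<zeta>' = - alpha A mul e g (\<omega> t) (\<zeta> t)" by (rule add_eq_0_iff2)
  also have "\<dots> \<longleftrightarrow> (\<zeta> has_vector_derivative - alpha A mul e g (\<omega> t) (\<zeta> t)) (at t within I)"
    using der vector_derivative_unique_within[OF nontriv der] by metis
  finally show ?thesis .
qed

end

theorem theorem1:
  fixes A :: "('a::{t2_space,second_countable_topology}, 'b::real_inner) atlas"
    and mul :: "'a \<Rightarrow> 'a \<Rightarrow> 'a" and e :: 'a and iv :: "'a \<Rightarrow> 'a"
    and g :: "'a \<Rightarrow> 'b \<Rightarrow> 'b \<Rightarrow> real"
    and nabla :: "('a \<Rightarrow> 'b) \<Rightarrow> ('a \<Rightarrow> 'b) \<Rightarrow> 'a \<Rightarrow> 'b"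
    and \<gamma> :: "real \<Rightarrow> 'a" and Y :: "real \<Rightarrow> 'b"
    and D :: "(real \<Rightarrow> 'b) \<Rightarrow> real \<Rightarrow> 'b"
  assumes "lie_group A mul e iv"
    and "riemannian_metric A g"
    and "left_invariant_metric A mul g"
    and "levi_civita A g nabla"
    and "smooth_curve A {0..1} \<gamma>"
    and "field_along A {0..1} \<gamma> Y"
    and "covariant_derivative_along A nabla {0..1} \<gamma> D"
  shows
    "((\<forall>t\<in>{0..1}. D Y t = 0) \<longleftrightarrow>
      (\<exists>\<omega> \<zeta>. \<forall>t\<in>{0..1}.
         \<omega> t = inv (dL A mul (\<gamma> t) e) (velocity A {0..1} \<gamma> t) \<and>
         Y t = dL A mul (\<gamma> t) e (\<zeta> t) \<and>
         (\<zeta> has_vector_derivative - alpha A mul e g (\<omega> t) (\<zeta> t)) (at t within {0..1})))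
     \<and>
     ((\<forall>t\<in>{0..1}. D Y t = 0) \<longleftrightarrow>
      (let \<omega> = (\<lambda>t. inv (dL A mul (\<gamma> t) e) (velocity A {0..1} \<gamma> t));
           \<zeta> = (\<lambda>t. inv (dL A mul (\<gamma> t) e) (Y t))
       in \<forall>t\<in>{0..1}.
         (\<zeta> has_vector_derivative - alpha A mul e g (\<omega> t) (\<zeta> t)) (at t within {0..1})))"
proof -
  interpret left_invariant_levi_civita A mul e iv g nabla
    using assms by unfold_locales (simp_all add: lie_group_def)
  define \<omega> where "\<omega> = (\<lambda>t. inv (dL A mul (\<gamma> t) e) (velocity A {0..1} \<gamma> t))"
  define \<zeta> where "\<zeta> = (\<lambda>t. inv (dL A mul (\<gamma> t) e) (Y t))"
  \<comment> \<open>Every point of the unit interval, the end points included, is a limit point of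
    it, so one-sided derivatives are unique.\<close>
  have nontriv: "at t within {0..1} \<noteq> bot" if "t \<in> {0..1}" for t :: real
    using that islimpt_Icc[of 0 1 t] by (simp add: trivial_limit_within)
  have par: "D Y t = 0 \<longleftrightarrow>
      (\<zeta> has_vector_derivative - alpha A mul e g (\<omega> t) (\<zeta> t)) (at t within {0..1})"
    if "t \<in> {0..1}" for t
    unfolding \<omega>_def \<zeta>_def using parallel_iff[OF assms(5-7) that nontriv[OF that]] .
  have Y: "Y t = dL A mul (\<gamma> t) e (\<zeta> t)" for t
    by (simp add: \<zeta>_def surj_f_inv_f[OF bij_is_surj[OF bij_dL]])
  \<comment> \<open>Competing curves are constrained only on the unit interval. There injectivity of
    \<open>dL\<close> forces them to equal \<omega> and \<zeta>, and a derivative within the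
    interval ignores values outside it.\<close>
  have unique: "(\<zeta> has_vector_derivative - alpha A mul e g (\<omega> t) (\<zeta> t)) (at t within {0..1})"
    if H: "\<forall>t\<in>{0..1}. \<omega>' t = \<omega> t \<and> Y t = dL A mul (\<gamma> t) e (\<zeta>' t) \<and>
         (\<zeta>' has_vector_derivative - alpha A mul e g (\<omega>' t) (\<zeta>' t)) (at t within {0..1})"
      and t: "t \<in> {0..1}" for \<omega>' \<zeta>' t
  proof -
    have eq: "\<zeta>' s = \<zeta> s" if "s \<in> {0..1}" for s
      using H that by (simp add: \<zeta>_def inv_f_f[OF bij_is_inj[OF bij_dL]])
    have "(\<zeta>' has_vector_derivative - alpha A mul e g (\<omega> t) (\<zeta> t)) (at t within {0..1})"
      using H t eq by metis
    then show ?thesis using has_vector_derivative_transform[OF t, of \<zeta> \<zeta>'] eq by simp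
  qed
  have "(\<forall>t\<in>{0..1}. D Y t = 0) \<longleftrightarrow>
      (\<exists>\<omega>' \<zeta>'. \<forall>t\<in>{0..1}. \<omega>' t = \<omega> t \<and> Y t = dL A mul (\<gamma> t) e (\<zeta>' t) \<and>
         (\<zeta>' has_vector_derivative - alpha A mul e g (\<omega>' t) (\<zeta>' t)) (at t within {0..1}))"
  proof
    assume "\<forall>t\<in>{0..1}. D Y t = 0"
    then show "\<exists>\<omega>' \<zeta>'. \<forall>t\<in>{0..1}. \<omega>' t = \<omega> t \<and> Y t = dL A mul (\<gamma> t) e (\<zeta>' t) \<and>
         (\<zeta>' has_vector_derivative - alpha A mul e g (\<omega>' t) (\<zeta>' t)) (at t within {0..1})"
      using par Y by (intro exI[of _ \<omega>] exI[of _ \<zeta>]) simp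
  next
    assume "\<exists>\<omega>' \<zeta>'. \<forall>t\<in>{0..1}. \<omega>' t = \<omega> t \<and> Y t = dL A mul (\<gamma> t) e (\<zeta>' t) \<and>
         (\<zeta>' has_vector_derivative - alpha A mul e g (\<omega>' t) (\<zeta>' t)) (at t within {0..1})"
    then obtain \<omega>' \<zeta>' where "\<forall>t\<in>{0..1}. \<omega>' t = \<omega> t \<and> Y t = dL A mul (\<gamma> t) e (\<zeta>' t) \<and>
         (\<zeta>' has_vector_derivative - alpha A mul e g (\<omega>' t) (\<zeta>' t)) (at t within {0..1})"
      by (elim exE)
    from unique[OF this] show "\<forall>t\<in>{0..1}. D Y t = 0" using par by simp
  qed
  moreover have "(\<forall>t\<in>{0..1}. D Y t = 0) \<longleftrightarrow> (\<forall>t\<in>{0..1}.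
      (\<zeta> has_vector_derivative - alpha A mul e g (\<omega> t) (\<zeta> t)) (at t within {0..1}))"
    using par by simp
  ultimately show ?thesis unfolding Let_def \<omega>_def \<zeta>_def by (rule conjI)
qed

end
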